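(* Let $(X,d)$ be a complete, proper, separable metric space which is a length space, and let $P$ be a Markov probability kernel on $X$. Suppose that for some constant $C\ge0$, $$|\nabla Pf|^2\le C\,P(|\nabla f|^2)\quad\text{pointwise on }X,\qquad\text{for all } f\in\mathrm{Lip}_b(X).$$ Then for every $b\ge0$ and all $\mu_0,\mu_1\in\mathcal P(X)$, $$W_{C,b}(\mu_0P,\mu_1P)\le W_{1,b}(\mu_0,\mu_1).$$ In particular (case $b=0$), $W_2(\mu_0P,\mu_1P)^2\le C\,W_2(\mu_0,\mu_1)^2$ for all $\mu_0,\mu_1\in\mathcal P(X)$.
   Context: For $f:X\to\mathbb R$, $|\nabla f|(x)=\lim_{r\to0}\sup_{0<d(x,y)\le r}\frac{|f(x)-f(y)|}{d(x,y)}$. $\mathrm{Lip}_b(X)$ is the Banach space of bounded Lipschitz functions on $X$ and $\mathcal P(X)$ the set of Borel probability measures on $X$. The Markov kernel $P:X\times\mathcal B_X\to[0,1]$ acts by $Pf(x)=\int_X f(y)\,P(x,dy)$ and $\mu P(A)=\int_X P(x,A)\,\mu(dx)$. For $a,b\ge0$ let $\mathcal A_{a,b}$ be the class of all $\varphi=\varphi_s(x)\in C^1([0,1],\mathrm{Lip}_b(X))$ satisfying $\partial_s\varphi_s+a|\nabla\varphi_s|^2+b\varphi_s^2\le0$. For $\mu_0,\mu_1\in\mathcal P(X)$ set $W_{a,b}(\mu_0,\mu_1)=\sup_{\varphi\in\mathcal A_{a,b}}\left[\int_X\varphi_1\,d\mu_1-\int_X\varphi_0\,d\mu_0\right]$ (possibly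 $+\infty$). The $2$-Kantorovich--Wasserstein distance is $W_2(\mu_0,\mu_1)^2=\inf_\pi\int d(x_0,x_1)^2\,\pi(dx_0,dx_1)$ (possibly $+\infty$), the infimum over all couplings $\pi$ of $\mu_0,\mu_1$. Convention: $0\cdot\infty=0$. *)

theory Defs
  imports "HOL-Probability.Probability"
begin

subsection \<open>Length spaces\<close>

definition curve_length :: "(real \<Rightarrow> 'a::metric_space) \<Rightarrow> ennreal" where
  "curve_length \<gamma> =
     (SUP (n, t) \<in> {(n :: nat, t :: nat \<Rightarrow> real). mono_on {..n} t \<and> t ` {..n} \<subseteq> {0..1}}.
        \<Sum>i<n. ennreal (dist (\<gamma> (t i)) (\<gamma> (t (Suc i)))))"

text \<open>The infimum over the empty set of curves is \<open>\<infinity>\<close>, so a length space is path connected.\<close>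

definition length_space :: "'a::metric_space set \<Rightarrow> bool" where
  "length_space S \<longleftrightarrow>
     (\<forall>x\<in>S. \<forall>y\<in>S. ennreal (dist x y) =
        (INF \<gamma> \<in> {\<gamma>. path \<gamma> \<and> path_image \<gamma> \<subseteq> S \<and> pathstart \<gamma> = x \<and> pathfinish \<gamma> = y}.
           curve_length \<gamma>))"

subsection \<open>The local Lipschitz constant\<close>

text \<open>The value is \<open>\<infinity>\<close> where the difference quotients are unbounded, and \<open>0\<close> at an
  isolated point (supremum of the empty set). The limit always exists, since the supremum is
  monotone in the radius.\<close>

definition slope :: "('a::metric_space \<Rightarrow> real) \<Rightarrow> 'a \<Rightarrow> ennreal" where
  "slope f x =
     Lim (at_right 0) (\<lambda>r. SUP y \<in> {y. 0 < dist x y \<and> dist x y \<le> r}.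
       ennreal (\<bar>f x - f y\<bar> / dist x y))"

lemma slope_tendsto:
  "((\<lambda>r. SUP y \<in> {y. 0 < dist x y \<and> dist x y \<le> r}. ennreal (\<bar>f x - f y\<bar> / dist x y))
     \<longlongrightarrow> slope f x) (at_right 0)"
  and slope_eq_INF:
  "slope f x =
     (INF r \<in> {0<..}. SUP y \<in> {y. 0 < dist x y \<and> dist x y \<le> r}. ennreal (\<bar>f x - f y\<bar> / dist x y))"
proof -
  let ?S = "\<lambda>r. SUP y \<in> {y. 0 < dist x y \<and> dist x y \<le> r}. ennreal (\<bar>f x - f y\<bar> / dist x y)"
  have mono: "?S r \<le> ?S r'" if "r \<le> r'" for r r'
    using that by (intro SUP_subset_mono) auto
  have lim: "(?S \<longlongrightarrow> (INF r \<in> {0<..}. ?S r)) (at_right 0)"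
  proof (rule order_tendstoI)
    fix a assume "a < (INF r \<in> {0<..}. ?S r)"
    then have "a < ?S r" if "0 < r" for r
      using that by (meson INF_lower greaterThan_iff less_le_trans)
    then show "\<forall>\<^sub>F r in at_right 0. a < ?S r"
      by (intro eventually_at_right_less[THEN eventually_mono]) auto
  next
    fix a assume "(INF r \<in> {0<..}. ?S r) < a"
    then obtain d where d: "0 < d" "?S d < a"
      by (auto simp: INF_less_iff)
    then have "?S r < a" if "r \<le> d" for r
      using mono[OF that] by (rule_tac le_less_trans)
    then show "\<forall>\<^sub>F r in at_right 0. ?S r < a"
      using d(1) by (auto simp: eventually_at_right_field intro!: exI[of _ d])
  qed
  then show eq: "slope f x = (INF r \<in> {0<..}. ?S r)"
    unfolding slope_def by (intro tendsto_Lim) auto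
  show "(?S \<longlongrightarrow> slope f x) (at_right 0)"
    using lim unfolding eq .
qed

subsection \<open>The Banach space of bounded Lipschitz functions\<close>

text \<open>The norm is \<open>sup \<bar>f\<bar> + Lip f\<close>, with \<open>Lip f\<close> the least global Lipschitz constant.\<close>

typedef (overloaded) ('a::metric_space) lip_b =
  "{f :: 'a \<Rightarrow> real. bounded (range f) \<and> (\<exists>L. L-lipschitz_on UNIV f)}"
  morphisms lip_fun Lip_b
  by (rule exI[of _ "\<lambda>_. 0"]) (auto intro: lipschitz_on_constant)

setup_lifting type_definition_lip_b

definition sup_norm :: "('a \<Rightarrow> real) \<Rightarrow> real" where
  "sup_norm f = (SUP x. \<bar>f x\<bar>)"

definition lip_const :: "('a::metric_space \<Rightarrow> real) \<Rightarrow> real" where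
  "lip_const f = Inf {L. L-lipschitz_on UNIV f}"

lemma sup_norm_upper: "bounded (range f) \<Longrightarrow> \<bar>f x\<bar> \<le> sup_norm f"
  unfolding sup_norm_def
  by (intro cSUP_upper) (auto simp: bounded_iff bdd_above_def)

lemma sup_norm_least: "(\<And>x. \<bar>f x\<bar> \<le> M) \<Longrightarrow> sup_norm f \<le> M"
  unfolding sup_norm_def by (intro cSUP_least) auto

lemma lip_const_lipschitz:
  assumes "L-lipschitz_on UNIV f"
  shows "(lip_const f)-lipschitz_on UNIV f"
proof (rule lipschitz_onI)
  have ne: "{L. L-lipschitz_on UNIV f} \<noteq> {}" using assms by auto
  show "0 \<le> lip_const f"
    unfolding lip_const_def by (rule cInf_greatest[OF ne]) (auto dest: lipschitz_on_nonneg)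
  fix x y
  show "dist (f x) (f y) \<le> lip_const f * dist x y"
  proof (cases "x = y")
    case False
    then have "dist (f x) (f y) / dist x y \<le> lip_const f"
      unfolding lip_const_def
      by (intro cInf_greatest[OF ne]) (auto dest: lipschitz_onD simp: divide_le_eq)
    then show ?thesis using False by (simp add: divide_le_eq)
  qed simp
qed

lemma lip_const_le: "L-lipschitz_on UNIV f \<Longrightarrow> lip_const f \<le> L"
  unfolding lip_const_def
  by (intro cInf_lower) (auto simp: bdd_below_def dest: lipschitz_on_nonneg)

lemma bounded_lip_fun: "bounded (range (lip_fun f))"
  using lip_fun[of f] by auto

lemma lipschitz_lip_fun: "(lip_const (lip_fun f))-lipschitz_on UNIV (lip_fun f)"
  using lip_fun[of f] by (auto intro: lip_const_lipschitz)

instantiation lip_b :: (metric_space) real_vector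
begin

lift_definition zero_lip_b :: "'a lip_b" is "\<lambda>_. 0"
  by (auto intro: lipschitz_on_constant)

lift_definition plus_lip_b :: "'a lip_b \<Rightarrow> 'a lip_b \<Rightarrow> 'a lip_b" is "\<lambda>f g x. f x + g x"
proof -
  fix f g :: "'a \<Rightarrow> real"
  assume "bounded (range f) \<and> (\<exists>L. L-lipschitz_on UNIV f)" "bounded (range g) \<and> (\<exists>L. L-lipschitz_on UNIV g)"
  then show "bounded (range (\<lambda>x. f x + g x)) \<and> (\<exists>L. L-lipschitz_on UNIV (\<lambda>x. f x + g x))"
    using bounded_plus_comp[of f UNIV g] lipschitz_on_add[of _ UNIV f _ g] by metis
qed

lift_definition minus_lip_b :: "'a lip_b \<Rightarrow> 'a lip_b \<Rightarrow> 'a lip_b" is "\<lambda>f g x. f x - g x"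
proof -
  fix f g :: "'a \<Rightarrow> real"
  assume "bounded (range f) \<and> (\<exists>L. L-lipschitz_on UNIV f)" "bounded (range g) \<and> (\<exists>L. L-lipschitz_on UNIV g)"
  then show "bounded (range (\<lambda>x. f x - g x)) \<and> (\<exists>L. L-lipschitz_on UNIV (\<lambda>x. f x - g x))"
    using bounded_minus_comp[of f UNIV g] lipschitz_on_diff[of _ UNIV f _ g] by metis
qed

lift_definition uminus_lip_b :: "'a lip_b \<Rightarrow> 'a lip_b" is "\<lambda>f x. - f x"
  by (auto intro: lipschitz_on_minus)

lift_definition scaleR_lip_b :: "real \<Rightarrow> 'a lip_b \<Rightarrow> 'a lip_b" is "\<lambda>c f x. c * f x"
proof -
  fix c and f :: "'a \<Rightarrow> real"
  assume "bounded (range f) \<and> (\<exists>L. L-lipschitz_on UNIV f)"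
  then show "bounded (range (\<lambda>x. c * f x)) \<and> (\<exists>L. L-lipschitz_on UNIV (\<lambda>x. c * f x))"
    using bounded_scaleR_comp[of f UNIV c] lipschitz_on_cmult_real[of _ UNIV f c]
    unfolding real_scaleR_def by metis
qed

instance
  by standard (transfer; auto simp: algebra_simps)+

end

instantiation lip_b :: (metric_space) real_normed_vector
begin

definition norm_lip_b :: "'a lip_b \<Rightarrow> real" where
  "norm_lip_b f = sup_norm (lip_fun f) + lip_const (lip_fun f)"

definition dist_lip_b :: "'a lip_b \<Rightarrow> 'a lip_b \<Rightarrow> real" where
  "dist_lip_b f g = norm (f - g)"

definition sgn_lip_b :: "'a lip_b \<Rightarrow> 'a lip_b" where
  "sgn_lip_b f = f /\<^sub>R norm f"

definition uniformity_lip_b :: "('a lip_b \<times> 'a lip_b) filter" where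
  "uniformity_lip_b = (INF e\<in>{0 <..}. principal {(x, y). dist x y < e})"

definition open_lip_b :: "'a lip_b set \<Rightarrow> bool" where
  "open_lip_b S = (\<forall>x\<in>S. \<forall>\<^sub>F (x', y) in uniformity. x' = x \<longrightarrow> y \<in> S)"

instance
proof
  fix f g :: "'a lip_b" and c :: real and S :: "'a lip_b set"
  show "dist f g = norm (f - g)" by (rule dist_lip_b_def)
  show "sgn f = f /\<^sub>R norm f" by (rule sgn_lip_b_def)
  show "uniformity = (INF e\<in>{0 <..}. principal {(x :: 'a lip_b, y). dist x y < e})"
    by (rule uniformity_lip_b_def)
  show "open S = (\<forall>x\<in>S. \<forall>\<^sub>F (x', y) in uniformity. x' = x \<longrightarrow> y \<in> S)"
    by (rule open_lip_b_def)
  have nn: "0 \<le> sup_norm (lip_fun h)" "0 \<le> lip_const (lip_fun h)" for h :: "'a lip_b"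
    using sup_norm_upper[OF bounded_lip_fun, of h undefined]
      lipschitz_on_nonneg[OF lipschitz_lip_fun, of h] by auto
  have zero: "norm (0 :: 'a lip_b) = 0"
    using sup_norm_least[of "lip_fun (0 :: 'a lip_b)" 0]
      lip_const_le[of 0 "lip_fun (0 :: 'a lip_b)"] nn[of 0]
    by (simp add: norm_lip_b_def zero_lip_b.rep_eq lipschitz_on_constant)
  show "norm f = 0 \<longleftrightarrow> f = 0"
  proof
    assume "norm f = 0"
    then have "sup_norm (lip_fun f) = 0"
      using nn[of f] by (simp add: norm_lip_b_def)
    then have "lip_fun f = lip_fun 0"
      using sup_norm_upper[OF bounded_lip_fun, of f] by (auto simp: zero_lip_b.rep_eq)
    then show "f = 0" by (simp add: lip_fun_inject)
  qed (simp add: zero)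
  show "norm (f + g) \<le> norm f + norm g"
  proof -
    have "sup_norm (lip_fun (f + g)) \<le> sup_norm (lip_fun f) + sup_norm (lip_fun g)"
      using sup_norm_upper[OF bounded_lip_fun, of f] sup_norm_upper[OF bounded_lip_fun, of g]
      by (intro sup_norm_least)
        (auto simp: plus_lip_b.rep_eq intro: order_trans[OF abs_triangle_ineq] add_mono)
    moreover have "lip_const (lip_fun (f + g)) \<le> lip_const (lip_fun f) + lip_const (lip_fun g)"
      by (intro lip_const_le)
        (simp add: plus_lip_b.rep_eq lipschitz_on_add lipschitz_lip_fun)
    ultimately show ?thesis by (simp add: norm_lip_b_def)
  qed
  have le: "norm (c *\<^sub>R h) \<le> \<bar>c\<bar> * norm h" for c and h :: "'a lip_b"
  proof -
    have "sup_norm (lip_fun (c *\<^sub>R h)) \<le> \<bar>c\<bar> * sup_norm (lip_fun h)"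
      using sup_norm_upper[OF bounded_lip_fun, of h]
      by (intro sup_norm_least) (auto simp: scaleR_lip_b.rep_eq abs_mult intro: mult_left_mono)
    moreover have "lip_const (lip_fun (c *\<^sub>R h)) \<le> \<bar>c\<bar> * lip_const (lip_fun h)"
      by (intro lip_const_le)
        (simp add: scaleR_lip_b.rep_eq lipschitz_on_cmult_real lipschitz_lip_fun)
    ultimately show ?thesis by (simp add: norm_lip_b_def distrib_left)
  qed
  show "norm (c *\<^sub>R f) = \<bar>c\<bar> * norm f"
  proof (cases "c = 0")
    case False
    have "norm f \<le> \<bar>inverse c\<bar> * norm (c *\<^sub>R f)"
      using le[of "inverse c" "c *\<^sub>R f"] False by simp
    then have "\<bar>c\<bar> * norm f \<le> norm (c *\<^sub>R f)"
      using False by (simp add: field_simps)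
    then show ?thesis using le[of c f] by simp
  qed (simp add: zero)
qed

end

instance lip_b :: (metric_space) banach
proof
  fix X :: "nat \<Rightarrow> 'a lip_b"
  assume X: "Cauchy X"
  let ?d = "\<lambda>m n x. lip_fun (X m) x - lip_fun (X n) x"
  have lip_nn: "0 \<le> lip_const (lip_fun h)" for h :: "'a lip_b"
    by (rule lipschitz_on_nonneg[OF lipschitz_lip_fun])
  have sup_nn: "0 \<le> sup_norm (lip_fun h)" for h :: "'a lip_b"
    using sup_norm_upper[OF bounded_lip_fun, of h undefined] by auto
  have "\<exists>N. \<forall>m\<ge>N. \<forall>n\<ge>N. (\<forall>x. \<bar>?d m n x\<bar> \<le> e) \<and> e-lipschitz_on UNIV (?d m n)"
    if e: "0 < e" for e
  proof -
    obtain N where N: "\<And>m n. m \<ge> N \<Longrightarrow> n \<ge> N \<Longrightarrow> norm (X m - X n) < e"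
      using CauchyD[OF X e] by auto
    have "\<bar>?d m n x\<bar> \<le> e" "e-lipschitz_on UNIV (?d m n)" if "m \<ge> N" "n \<ge> N" for m n x
    proof -
      let ?h = "X m - X n"
      have *: "sup_norm (lip_fun ?h) \<le> e" "lip_const (lip_fun ?h) \<le> e"
        using N[OF that] lip_nn[of ?h] sup_nn[of ?h] by (auto simp: norm_lip_b_def)
      show "\<bar>?d m n x\<bar> \<le> e"
        using sup_norm_upper[OF bounded_lip_fun, of ?h x] *(1) by (simp add: minus_lip_b.rep_eq)
      show "e-lipschitz_on UNIV (?d m n)"
        using lipschitz_on_le[OF lipschitz_lip_fun *(2)] by (simp add: minus_lip_b.rep_eq)
    qed
    then show ?thesis by blast
  qed
  then obtain N where N: "\<And>e m n x. 0 < e \<Longrightarrow> m \<ge> N e \<Longrightarrow> n \<ge> N e \<Longrightarrow> \<bar>?d m n x\<bar> \<le> e"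
      "\<And>e m n. 0 < e \<Longrightarrow> m \<ge> N e \<Longrightarrow> n \<ge> N e \<Longrightarrow> e-lipschitz_on UNIV (?d m n)"
    by metis
  have "convergent (\<lambda>n. lip_fun (X n) x)" for x
  proof (rule real_Cauchy_convergent, rule CauchyI)
    fix e :: real assume "0 < e"
    then show "\<exists>M. \<forall>m\<ge>M. \<forall>n\<ge>M. norm (?d m n x) < e"
      using N(1)[of "e/2" _ _ x] by (intro exI[of _ "N (e/2)"]) fastforce
  qed
  then obtain F where F: "\<And>x. (\<lambda>n. lip_fun (X n) x) \<longlonglongrightarrow> F x"
    unfolding convergent_def by metis
  have near: "\<bar>lip_fun (X m) x - F x\<bar> \<le> e" if "0 < e" "m \<ge> N e" for e m x
    by (rule tendsto_upperbound[where F = sequentially and f = "\<lambda>n. \<bar>?d m n x\<bar>"])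
      (auto intro!: tendsto_intros F eventually_sequentiallyI[of "N e"] N(1) that)
  have near_lip: "e-lipschitz_on UNIV (\<lambda>x. lip_fun (X m) x - F x)" if "0 < e" "m \<ge> N e" for e m
  proof (rule lipschitz_onI)
    fix x y
    show "dist (lip_fun (X m) x - F x) (lip_fun (X m) y - F y) \<le> e * dist x y"
      by (rule tendsto_upperbound[where F = sequentially and f = "\<lambda>n. dist (?d m n x) (?d m n y)"])
        (auto intro!: tendsto_intros F eventually_sequentiallyI[of "N e"]
          lipschitz_onD[OF N(2)] that)
  qed (use that in simp)
  let ?n = "N 1"
  have "F = (\<lambda>x. lip_fun (X ?n) x - (lip_fun (X ?n) x - F x))" by auto
  moreover have "bounded (range (\<lambda>x. lip_fun (X ?n) x - (lip_fun (X ?n) x - F x)))"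
    by (rule bounded_minus_comp[OF bounded_lip_fun])
      (auto simp: bounded_iff intro!: exI[of _ 1] near)
  moreover have "\<exists>L. L-lipschitz_on UNIV (\<lambda>x. lip_fun (X ?n) x - (lip_fun (X ?n) x - F x))"
    by (rule exI[of _ "lip_const (lip_fun (X ?n)) + 1"],
        intro lipschitz_on_diff lipschitz_lip_fun near_lip)
      auto
  ultimately have "F \<in> {f. bounded (range f) \<and> (\<exists>L. L-lipschitz_on UNIV f)}"
    by simp
  then obtain G where G: "lip_fun G = F"
    using Lip_b_inverse by blast
  have "X \<longlonglongrightarrow> G"
  proof (rule LIMSEQ_I)
    fix e :: real assume e: "0 < e"
    have "norm (X m - G) < e" if m: "m \<ge> N (e/3)" for m
    proof -
      have "sup_norm (lip_fun (X m - G)) \<le> e/3"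
        using near[of "e/3" m] e m by (intro sup_norm_least) (simp add: minus_lip_b.rep_eq G)
      moreover have "lip_const (lip_fun (X m - G)) \<le> e/3"
        using near_lip[of "e/3" m] e m by (intro lip_const_le) (simp add: minus_lip_b.rep_eq G)
      ultimately show ?thesis using e by (simp add: norm_lip_b_def)
    qed
    then show "\<exists>M. \<forall>m\<ge>M. norm (X m - G) < e" by blast
  qed
  then show "convergent X" by (rule convergentI)
qed

subsection \<open>The transport-type costs\<close>

text \<open>Curves \<open>\<phi>\<close> are functions on \<open>real\<close> of which only the restriction to \<open>{0..1}\<close> matters; the
  derivative \<open>\<psi> s\<close> is taken in the norm of \<open>lip_b\<close> and is one-sided at the endpoints. The
  local Lipschitz constant of a Lipschitz function is finite, so \<open>enn2real\<close> loses nothing.\<close>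

definition HJ_class :: "real \<Rightarrow> real \<Rightarrow> (real \<Rightarrow> ('a::metric_space) lip_b) set" where
  "HJ_class a b =
     {\<phi>. \<exists>\<psi>. continuous_on {0..1} \<psi> \<and>
        (\<forall>s\<in>{0..1}. (\<phi> has_vector_derivative \<psi> s) (at s within {0..1})) \<and>
        (\<forall>s\<in>{0..1}. \<forall>x. lip_fun (\<psi> s) x + a * (enn2real (slope (lip_fun (\<phi> s)) x))\<^sup>2
           + b * (lip_fun (\<phi> s) x)\<^sup>2 \<le> 0)}"

definition HJ_cost :: "real \<Rightarrow> real \<Rightarrow> 'a::metric_space measure \<Rightarrow> 'a measure \<Rightarrow> ereal" where
  "HJ_cost a b \<mu>\<^sub>0 \<mu>\<^sub>1 =
     (SUP \<phi> \<in> HJ_class a b.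
        ereal ((\<integral>x. lip_fun (\<phi> 1) x \<partial>\<mu>\<^sub>1) - (\<integral>x. lip_fun (\<phi> 0) x \<partial>\<mu>\<^sub>0)))"

lemma slope_lip_fun_finite: "slope (lip_fun f) x < \<infinity>"
proof -
  let ?L = "lip_const (lip_fun f)"
  have "slope (lip_fun f) x \<le> (SUP y \<in> {y. 0 < dist x y \<and> dist x y \<le> 1}.
      ennreal (\<bar>lip_fun f x - lip_fun f y\<bar> / dist x y))"
    unfolding slope_eq_INF by (rule INF_lower) simp
  also have "\<dots> \<le> ennreal ?L"
    using lipschitz_onD[OF lipschitz_lip_fun, of x _ f]
    by (intro SUP_least ennreal_leI) (auto simp: divide_le_eq dist_real_def)
  finally show ?thesis by (simp add: le_less_trans)
qed

subsection \<open>The 2-Kantorovich--Wasserstein distance\<close>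

definition couplings :: "'a measure \<Rightarrow> 'a measure \<Rightarrow> ('a \<times> 'a) measure set" where
  "couplings \<mu> \<nu> =
     {\<pi>. sets \<pi> = sets (\<mu> \<Otimes>\<^sub>M \<nu>) \<and> distr \<pi> \<mu> fst = \<mu> \<and> distr \<pi> \<nu> snd = \<nu>}"

definition ennsqrt :: "ennreal \<Rightarrow> ennreal" where
  "ennsqrt c = (if c = \<infinity> then \<infinity> else ennreal (sqrt (enn2real c)))"

definition W2 :: "'a::metric_space measure \<Rightarrow> 'a measure \<Rightarrow> ennreal" where
  "W2 \<mu> \<nu> = ennsqrt (INF \<pi> \<in> couplings \<mu> \<nu>. \<integral>\<^sup>+ (x, y). ennreal ((dist x y)\<^sup>2) \<partial>\<pi>)"

lemma ennsqrt_power2: "(ennsqrt c)\<^sup>2 = c"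
  by (cases c) (auto simp: ennsqrt_def ennreal_power)

lemma W2_power2: "(W2 \<mu> \<nu>)\<^sup>2 = (INF \<pi> \<in> couplings \<mu> \<nu>. \<integral>\<^sup>+ (x, y). ennreal ((dist x y)\<^sup>2) \<partial>\<pi>)"
  unfolding W2_def by (rule ennsqrt_power2)

end

theory Submission
  imports Defs
begin

text \<open>
  The first part is a pushforward of subsolutions. If \<open>\<phi>\<close> satisfies
  \<open>\<partial>\<^sub>s\<phi> + C \<bar>\<nabla>\<phi>\<bar>\<^sup>2 + b \<phi>\<^sup>2 \<le> 0\<close>, then applying \<open>P\<close> and using the gradient estimate and Jensen's
  inequality shows that \<open>P\<phi>\<close> satisfies the same inequality with \<open>C\<close> replaced by \<open>1\<close>
  (\<open>HJ_class_P_lip\<close>), and \<open>\<integral> P\<phi> d\<mu> = \<integral> \<phi> d(\<mu>P)\<close>. In a length space the gradient estimate makes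
  \<open>P\<close> a bounded operator on the bounded Lipschitz functions, so it preserves \<open>C\<^sup>1\<close> curves.

  The second part is Kuwada's duality argument, carried out with finite differences in time. By
  Kantorovich duality it is enough that \<open>g(y) - f(x) \<le> d(x,y)\<^sup>2\<close> implies
  \<open>Pg(y) - Pf(x) \<le> C d(x,y)\<^sup>2\<close> for bounded Borel functions (\<open>dual_potential_contraction\<close>); this
  inequality is then integrated against an arbitrary coupling of the initial measures. The
  Hopf--Lax functions \<open>Q\<^sub>s f(x) = inf\<^sub>z (f(z) + d(x,z)\<^sup>2/s)\<close> interpolate between \<open>f\<close> and a majorant of
  \<open>g\<close>. Their decrease over a time interval dominates the squared local Lipschitz constant at its
  left end (\<open>slope_hopf_lax_le\<close>). This is a pointwise inequality between functions, so it passes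
  through \<open>P\<close> with only the constant changed. Following \<open>P Q\<^sub>s f\<close> along an almost shortest path from
  \<open>x\<close> to \<open>y\<close>, spatial growth is paid for by decrease in time, at a total cost of \<open>C d(x,y)\<^sup>2\<close>.
  Growth and decrease are compared at different points, which costs the Lipschitz norm of the
  decrease. Averaging over a short time window keeps the inequality by convexity and makes
  consecutive averages close in the Lipschitz norm, so that this cost becomes negligible
  (\<open>averaged_P_hopf_lax_bound\<close>).

  The hard half of Kantorovich duality (\<open>transport_cost_le_dual_bound\<close>) is obtained from discrete
  problems. For finitely many cells, minimizing the cost plus a quadratic penalty on the marginals
  produces almost-couplings, and its first-order conditions produce the dual potentials
  (\<open>penalized_transport\<close>). A diagonal limit gives an exact coupling of the masses of
  countably many cells (\<open>countable_transport\<close>), which lifts to the measures by spreading mass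
  independently inside the cells (\<open>cell_coupling\<close>); the error is controlled by the size of the
  cells.
\<close>

section \<open>Local Lipschitz constants in length spaces\<close>

lemma slope_leI:
  fixes f :: "'a::metric_space \<Rightarrow> real"
  assumes "0 \<le> S"
    and "\<And>\<theta>. 0 < \<theta> \<Longrightarrow> \<exists>r>0. \<forall>y. dist x y \<le> r \<longrightarrow> \<bar>f x - f y\<bar> \<le> (S + \<theta>) * dist x y"
  shows "slope f x \<le> ennreal S"
proof (rule ennreal_le_epsilon)
  fix e :: real assume e: "0 < e"
  from assms(2)[OF e] obtain r where r: "0 < r"
    "\<And>y. dist x y \<le> r \<Longrightarrow> \<bar>f x - f y\<bar> \<le> (S + e) * dist x y" by auto
  have "slope f x \<le> (SUP y \<in> {y. 0 < dist x y \<and> dist x y \<le> r}. ennreal (\<bar>f x - f y\<bar> / dist x y))"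
    unfolding slope_eq_INF using r(1) by (intro INF_lower) simp
  also have "\<dots> \<le> ennreal (S + e)"
    using r(2) by (intro SUP_least ennreal_leI) (auto simp: divide_le_eq)
  finally show "slope f x \<le> ennreal S + ennreal e"
    using assms(1) e by simp
qed

lemma slope_leD:
  fixes f :: "'a::metric_space \<Rightarrow> real"
  assumes "slope f x \<le> ennreal S" "0 \<le> S" "S < K"
  obtains r where "0 < r" "\<And>y. dist x y \<le> r \<Longrightarrow> \<bar>f x - f y\<bar> \<le> K * dist x y"
proof -
  have "slope f x < ennreal K"
    using assms by (meson ennreal_lessI le_less_trans less_le_trans not_le order_le_less_trans)
  then obtain r where r: "0 < r"
    "(SUP y \<in> {y. 0 < dist x y \<and> dist x y \<le> r}. ennreal (\<bar>f x - f y\<bar> / dist x y)) < ennreal K"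
    unfolding slope_eq_INF by (auto simp: INF_less_iff)
  have "\<bar>f x - f y\<bar> \<le> K * dist x y" if "dist x y \<le> r" for y
  proof (cases "x = y")
    case False
    then have "ennreal (\<bar>f x - f y\<bar> / dist x y) \<le> ennreal K"
      using that by (intro order_trans[OF SUP_upper less_imp_le[OF r(2)]]) auto
    then show ?thesis
      using False assms by (auto simp: divide_le_eq)
  qed simp
  then show thesis using that r(1) by blast
qed

text \<open>Near every parameter the increments of \<open>w\<close> are at most \<open>K\<close> times those of \<open>\<gamma>\<close>, for any
  \<open>K > S\<close>, and both increments of \<open>w\<close> and lengths of inscribed polygons add up over adjacent
  intervals. Bisection then gives one inscribed polygon that bounds the whole increment.\<close>

lemma slope_bound_along_path:
  fixes w :: "'a::metric_space \<Rightarrow> real"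
  assumes "path \<gamma>" and slope: "\<And>z. z \<in> path_image \<gamma> \<Longrightarrow> slope w z \<le> ennreal S"
    and S: "0 \<le> S" and len: "curve_length \<gamma> \<le> ennreal \<l>" and l: "0 \<le> \<l>"
  shows "\<bar>w (pathfinish \<gamma>) - w (pathstart \<gamma>)\<bar> \<le> S * \<l>"
proof -
  have cont: "continuous_on {0..1} \<gamma>" using assms(1) by (simp add: path_def)
  have main: "\<bar>w (\<gamma> 1) - w (\<gamma> 0)\<bar> \<le> K * \<l>" if K: "S < K" for K
  proof -
    define P where "P a b \<longleftrightarrow> (0 \<le> a \<and> b \<le> 1 \<longrightarrow> (\<exists>n (t :: nat \<Rightarrow> real). mono_on {..n} t \<and>
      t 0 = a \<and> t n = b \<and> \<bar>w (\<gamma> b) - w (\<gamma> a)\<bar> \<le> K * (\<Sum>i<n. dist (\<gamma> (t i)) (\<gamma> (t (Suc i))))))"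
      for a b
    have "P 0 1"
    proof (rule Bolzano)
      show "(0::real) \<le> 1" by simp
    next
      fix a b c :: real
      assume Pab: "P a b" and Pbc: "P b c" and ab: "a \<le> b" and bc: "b \<le> c"
      show "P a c" unfolding P_def
      proof
        assume "0 \<le> a \<and> c \<le> 1"
        then obtain n t n' t' where
          t: "mono_on {..n} t" "t 0 = a" "t n = b"
            "\<bar>w (\<gamma> b) - w (\<gamma> a)\<bar> \<le> K * (\<Sum>i<n. dist (\<gamma> (t i)) (\<gamma> (t (Suc i))))" and
          t': "mono_on {..n'} t'" "t' 0 = b" "t' n' = c"
            "\<bar>w (\<gamma> c) - w (\<gamma> b)\<bar> \<le> K * (\<Sum>i<n'. dist (\<gamma> (t' i)) (\<gamma> (t' (Suc i))))"
          using Pab Pbc ab bc unfolding P_def by auto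
        define u where "u i = (if i \<le> n then t i else t' (i - n))" for i
        have u2: "u (n + i) = t' i" for i
          using t(3) t'(2) by (auto simp: u_def)
        have "mono_on {..n + n'} u"
        proof (rule mono_onI)
          fix r s assume rs: "r \<in> {..n + n'}" "s \<in> {..n + n'}" "r \<le> s"
          consider "s \<le> n" | "r \<le> n" "n < s" | "n < r" by linarith
          then show "u r \<le> u s"
          proof cases
            case 1 then show ?thesis using rs mono_onD[OF t(1)] by (auto simp: u_def)
          next
            case 2
            have "t r \<le> t n" using 2 by (intro mono_onD[OF t(1)]) auto
            moreover have "t' 0 \<le> t' (s - n)" using 2 rs by (intro mono_onD[OF t'(1)]) auto
            ultimately show ?thesis using 2 t t' by (auto simp: u_def)
          next
            case 3
            have "t' (r - n) \<le> t' (s - n)" using 3 rs by (intro mono_onD[OF t'(1)]) auto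
            then show ?thesis using 3 rs by (auto simp: u_def)
          qed
        qed
        moreover have "u 0 = a" "u (n + n') = c" using t t' u2[of n'] by (auto simp: u_def)
        moreover have "(\<Sum>i<n + n'. dist (\<gamma> (u i)) (\<gamma> (u (Suc i)))) =
          (\<Sum>i<n. dist (\<gamma> (t i)) (\<gamma> (t (Suc i)))) + (\<Sum>i<n'. dist (\<gamma> (t' i)) (\<gamma> (t' (Suc i))))"
        proof -
          have "(\<Sum>i<n + n'. dist (\<gamma> (u i)) (\<gamma> (u (Suc i)))) =
            (\<Sum>i<n. dist (\<gamma> (u i)) (\<gamma> (u (Suc i)))) +
            (\<Sum>i<n'. dist (\<gamma> (u (n + i))) (\<gamma> (u (n + Suc i))))"
            by (induction n') (auto simp: add.assoc)
          then show ?thesis unfolding u2 by (simp add: u_def)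
        qed
        ultimately show "\<exists>n t. mono_on {..n} t \<and> t 0 = a \<and> t n = c \<and>
          \<bar>w (\<gamma> c) - w (\<gamma> a)\<bar> \<le> K * (\<Sum>i<n. dist (\<gamma> (t i)) (\<gamma> (t (Suc i))))"
          using t(4) t'(4) by (intro exI[of _ "n + n'"] exI[of _ u]) (auto simp: distrib_left)
      qed
    next
      fix x :: real assume x: "0 \<le> x" "x \<le> 1"
      then have "slope w (\<gamma> x) \<le> ennreal S" by (intro slope) (auto simp: path_image_def)
      from slope_leD[OF this S K] obtain r where r: "0 < r"
        "\<And>y. dist (\<gamma> x) y \<le> r \<Longrightarrow> \<bar>w (\<gamma> x) - w y\<bar> \<le> K * dist (\<gamma> x) y" by metis
      from cont x r(1) obtain d where d: "0 < d"
        "\<And>y. y \<in> {0..1} \<Longrightarrow> dist y x < d \<Longrightarrow> dist (\<gamma> y) (\<gamma> x) < r"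
        unfolding continuous_on_iff by (metis atLeastAtMost_iff)
      have "P a b" if ab: "a \<le> x" "x \<le> b" "b - a < d" for a b
        unfolding P_def
      proof
        assume "0 \<le> a \<and> b \<le> 1"
        then have "dist (\<gamma> a) (\<gamma> x) < r" "dist (\<gamma> b) (\<gamma> x) < r"
          using ab by (auto intro!: d(2) simp: dist_real_def)
        then have "\<bar>w (\<gamma> x) - w (\<gamma> a)\<bar> \<le> K * dist (\<gamma> x) (\<gamma> a)" "\<bar>w (\<gamma> x) - w (\<gamma> b)\<bar> \<le> K * dist (\<gamma> x) (\<gamma> b)"
          using r(2)[of "\<gamma> a"] r(2)[of "\<gamma> b"] by (simp_all add: dist_commute)
        then have "\<bar>w (\<gamma> b) - w (\<gamma> a)\<bar> \<le> K * (dist (\<gamma> a) (\<gamma> x) + dist (\<gamma> x) (\<gamma> b))"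
          by (auto simp: dist_commute distrib_left abs_if split: if_splits)
        then show "\<exists>n t. mono_on {..n} t \<and> t 0 = a \<and> t n = b \<and>
          \<bar>w (\<gamma> b) - w (\<gamma> a)\<bar> \<le> K * (\<Sum>i<n. dist (\<gamma> (t i)) (\<gamma> (t (Suc i))))"
          using ab by (intro exI[of _ "2::nat"] exI[of _ "\<lambda>i. if i = 0 then a else if i = 1 then x else b"])
            (auto simp: mono_on_def numeral_2_eq_2 lessThan_Suc add.commute)
      qed
      then show "\<exists>d>0. \<forall>a b. a \<le> x \<and> x \<le> b \<and> b - a < d \<longrightarrow> P a b"
        using d(1) by blast
    qed
    then obtain n and t :: "nat \<Rightarrow> real" where t: "mono_on {..n} t" "t 0 = 0" "t n = 1"
      "\<bar>w (\<gamma> 1) - w (\<gamma> 0)\<bar> \<le> K * (\<Sum>i<n. dist (\<gamma> (t i)) (\<gamma> (t (Suc i))))" unfolding P_def by auto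
    have "t i \<in> {0..1}" if "i \<le> n" for i
      using that mono_onD[OF t(1), of 0 i] mono_onD[OF t(1), of i n] t by auto
    then have "(\<Sum>i<n. ennreal (dist (\<gamma> (t i)) (\<gamma> (t (Suc i))))) \<le> curve_length \<gamma>"
      unfolding curve_length_def using t(1) by (intro SUP_upper2[of "(n, t)"]) auto
    also note len
    finally have "(\<Sum>i<n. dist (\<gamma> (t i)) (\<gamma> (t (Suc i)))) \<le> \<l>"
      using l by simp
    then show ?thesis using t(4) K S by (smt (verit) mult_left_mono)
  qed
  have "\<bar>w (\<gamma> 1) - w (\<gamma> 0)\<bar> \<le> S * \<l> + e" if e: "0 < e" for e
  proof -
    have "\<bar>w (\<gamma> 1) - w (\<gamma> 0)\<bar> \<le> (S + e / (\<l> + 1)) * \<l>" using e l by (intro main) simp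
    also have "\<dots> \<le> S * \<l> + e" using e l by (simp add: field_simps)
    finally show ?thesis .
  qed
  then show ?thesis unfolding pathfinish_def pathstart_def by (rule field_le_epsilon)
qed

lemma length_space_short_path:
  fixes x y :: "'a::metric_space"
  assumes "length_space (UNIV :: 'a set)" "dist x y < \<l>"
  obtains \<gamma> where "path \<gamma>" "pathstart \<gamma> = x" "pathfinish \<gamma> = y" "curve_length \<gamma> < ennreal \<l>"
proof -
  have "ennreal (dist x y) < ennreal \<l>"
    using assms(2) by (simp add: ennreal_less_iff)
  then have "(INF \<gamma> \<in> {\<gamma>. path \<gamma> \<and> path_image \<gamma> \<subseteq> UNIV \<and> pathstart \<gamma> = x \<and> pathfinish \<gamma> = y}.
           curve_length \<gamma>) < ennreal \<l>" using assms(1) unfolding length_space_def by simp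
  then show thesis using that by (auto simp: INF_less_iff)
qed

lemma dist_via_path_le_curve_length:
  assumes "t \<in> {0..1}"
  shows "ennreal (dist (\<gamma> 0) (\<gamma> t) + dist (\<gamma> t) (\<gamma> 1)) \<le> curve_length \<gamma>"
  unfolding curve_length_def using assms
  by (intro SUP_upper2[of "(2, \<lambda>i. if i = 0 then 0 else if i = 1 then t else 1)"])
    (auto simp: mono_on_def numeral_2_eq_2 lessThan_Suc add.commute)

text \<open>A path to \<open>y\<close> that is shorter than \<open>\<l>\<close> stays in the ball of radius \<open>\<l>\<close> around \<open>y\<close>. The
  bound is local because \<open>hamilton_jacobi_step\<close> controls the local Lipschitz constant only there.\<close>

lemma length_space_mean_value:
  fixes w :: "'a::metric_space \<Rightarrow> real"
  assumes "length_space (UNIV :: 'a set)" "dist x y < \<l>" "0 \<le> S"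
    and slope: "\<And>z. dist z y < \<l> \<Longrightarrow> slope w z \<le> ennreal S"
  shows "\<bar>w y - w x\<bar> \<le> S * \<l>"
proof -
  obtain \<gamma> where \<gamma>: "path \<gamma>" "pathstart \<gamma> = x" "pathfinish \<gamma> = y" "curve_length \<gamma> < ennreal \<l>"
    using length_space_short_path[OF assms(1,2)] .
  have l: "0 \<le> \<l>" using assms(2) zero_le_dist[of x y] by linarith
  have "slope w z \<le> ennreal S" if "z \<in> path_image \<gamma>" for z
  proof -
    from that obtain t where t: "t \<in> {0..1}" "z = \<gamma> t" by (auto simp: path_image_def)
    have "ennreal (dist x z + dist z y) < ennreal \<l>"
      using dist_via_path_le_curve_length[OF t(1), of \<gamma>] \<gamma> t(2)
      by (auto simp: pathstart_def pathfinish_def)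
    then have "dist x z + dist z y < \<l>" by (subst (asm) ennreal_less_iff) auto
    then have "dist z y < \<l>" using zero_le_dist[of x z] by linarith
    then show ?thesis by (rule slope)
  qed
  from slope_bound_along_path[OF \<gamma>(1) this assms(3) less_imp_le[OF \<gamma>(4)] l]
  show ?thesis unfolding \<gamma> .
qed

lemma length_space_lipschitz:
  fixes w :: "'a::metric_space \<Rightarrow> real"
  assumes "length_space (UNIV :: 'a set)" "0 \<le> S" "\<And>z. slope w z \<le> ennreal S"
  shows "S-lipschitz_on UNIV w"
proof (rule lipschitz_onI)
  fix x y
  show "dist (w x) (w y) \<le> S * dist x y"
  proof (rule field_le_epsilon)
    fix e :: real assume e: "0 < e"
    have "\<bar>w y - w x\<bar> \<le> S * (dist x y + e / (S + 1))"
      using e assms(2) by (intro length_space_mean_value[OF assms(1)] assms) auto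
    also have "\<dots> \<le> S * dist x y + e" using e assms(2) by (simp add: field_simps)
    finally show "dist (w x) (w y) \<le> S * dist x y + e" by (simp add: dist_real_def abs_minus_commute)
  qed
qed (rule assms)

lemma length_space_intermediate:
  fixes x y :: "'a::metric_space"
  assumes "length_space (UNIV :: 'a set)" "dist x y < a + b" "0 < a" "0 < b"
  obtains z where "dist x z < a" "dist z y < b"
proof (cases "dist x y < a")
  case True
  then show thesis using that[of y] assms(4) by simp
next
  case False
  \<comment> \<open>Room below \<open>a\<close> makes the first of the two inequalities strict.\<close>
  obtain a' where a': "max 0 (dist x y - b) < a'" "a' < a"
    using dense[of "max 0 (dist x y - b)" a] assms by auto
  then have "dist x y < a' + b" by simp
  then obtain \<gamma> where \<gamma>: "path \<gamma>" "pathstart \<gamma> = x" "pathfinish \<gamma> = y" "curve_length \<gamma> < ennreal (a' + b)"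
    using length_space_short_path[OF assms(1)] by metis
  have "\<exists>t\<ge>0. t \<le> 1 \<and> dist x (\<gamma> t) = a'"
    using \<gamma> a' False
    by (intro IVT') (auto simp: pathstart_def pathfinish_def path_def intro!: continuous_intros)
  then obtain t where t: "t \<in> {0..1}" "dist x (\<gamma> t) = a'" by auto
  have "ennreal (dist x (\<gamma> t) + dist (\<gamma> t) y) < ennreal (a' + b)"
    using dist_via_path_le_curve_length[OF t(1), of \<gamma>] \<gamma> by (auto simp: pathstart_def pathfinish_def)
  then have "dist x (\<gamma> t) + dist (\<gamma> t) y < a' + b" by (subst (asm) ennreal_less_iff) auto
  then have "dist (\<gamma> t) y < b" using t(2) by simp
  then show thesis using that[of "\<gamma> t"] t(2) a' by simp
qed

section \<open>Kernels with a gradient estimate\<close>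

lemma borel_measurable_lip_fun: "lip_fun f \<in> borel_measurable borel"
  by (rule borel_measurable_continuous_onI[OF lipschitz_on_continuous_on[OF lipschitz_lip_fun]])

lemma slope_lip_fun_le: "slope (lip_fun f) x \<le> ennreal (lip_const (lip_fun f))"
proof (rule slope_leI)
  show "0 \<le> lip_const (lip_fun f)" by (rule lipschitz_on_nonneg[OF lipschitz_lip_fun])
  fix \<theta> :: real assume "0 < \<theta>"
  have "\<bar>lip_fun f x - lip_fun f y\<bar> \<le> (lip_const (lip_fun f) + \<theta>) * dist x y" for y
  proof -
    have "\<bar>lip_fun f x - lip_fun f y\<bar> \<le> lip_const (lip_fun f) * dist x y"
      using lipschitz_onD[OF lipschitz_lip_fun, of x y f] by (simp add: dist_real_def)
    also have "\<dots> \<le> (lip_const (lip_fun f) + \<theta>) * dist x y"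
      using \<open>0 < \<theta>\<close> by (intro mult_right_mono) auto
    finally show ?thesis .
  qed
  then show "\<exists>r>0. \<forall>y. dist x y \<le> r \<longrightarrow>
      \<bar>lip_fun f x - lip_fun f y\<bar> \<le> (lip_const (lip_fun f) + \<theta>) * dist x y"
    by (intro exI[of _ 1]) auto
qed

lemma sup_norm_nonneg: "0 \<le> sup_norm (lip_fun f)"
  using sup_norm_upper[OF bounded_lip_fun, of f undefined] by linarith

lemma ennreal_power2_le_imp_le:
  assumes "(x :: ennreal)\<^sup>2 \<le> ennreal (K\<^sup>2)" "0 \<le> K"
  shows "x \<le> ennreal K"
  using assms by (cases x) (auto simp: ennreal_power top_unique intro: power2_le_imp_le)

locale gradient_kernel =
  fixes P :: "'a::{second_countable_topology, metric_space} \<Rightarrow> 'a measure" and C :: real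
  assumes length: "length_space (UNIV :: 'a set)"
    and P_meas: "P \<in> borel \<rightarrow>\<^sub>M prob_algebra borel"
    and C_nonneg: "C \<ge> 0"
    and grad: "\<And>(f :: 'a lip_b) x. (slope (\<lambda>z. \<integral>y. lip_fun f y \<partial>P z) x)\<^sup>2
           \<le> ennreal C * (\<integral>\<^sup>+y. (slope (lip_fun f) y)\<^sup>2 \<partial>P x)"
begin

lemma P_prob: "prob_space (P x)" and P_sets: "sets (P x) = sets borel"
proof -
  have "P x \<in> space (prob_algebra borel)" using measurable_space[OF P_meas] by simp
  then show "prob_space (P x)" "sets (P x) = sets borel"
    by (auto simp: space_prob_algebra)
qed

lemma P_subprob_meas: "P \<in> borel \<rightarrow>\<^sub>M subprob_algebra borel"
  using P_meas by (rule measurable_prob_algebraD)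

lemma P_measurable [simp]: "f \<in> borel_measurable borel \<Longrightarrow> f \<in> borel_measurable (P x)"
  by (simp add: measurable_cong_sets[OF P_sets refl])

lemma P_integrable:
  fixes f :: "'a \<Rightarrow> real"
  assumes "f \<in> borel_measurable borel" "\<And>y. \<bar>f y\<bar> \<le> M"
  shows "integrable (P x) f"
proof -
  interpret prob_space "P x" by (rule P_prob)
  show ?thesis using assms by (intro integrable_const_bound[of _ M]) auto
qed

lemma P_integral_bound:
  fixes f :: "'a \<Rightarrow> real"
  assumes "f \<in> borel_measurable borel" "\<And>y. \<bar>f y\<bar> \<le> M"
  shows "\<bar>\<integral>y. f y \<partial>P x\<bar> \<le> M"
proof -
  interpret prob_space "P x" by (rule P_prob)
  have *: "f y \<le> M" "- M \<le> f y" for y using assms(2)[of y] by auto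
  have "(\<integral>y. f y \<partial>P x) \<le> M"
    using * by (intro integral_le_const P_integrable[OF assms]) auto
  moreover have "- M \<le> (\<integral>y. f y \<partial>P x)"
    using * by (intro integral_ge_const P_integrable[OF assms]) auto
  ultimately show ?thesis by linarith
qed

lemma P_integral_measurable:
  fixes f :: "'a \<Rightarrow> real"
  assumes "f \<in> borel_measurable borel"
  shows "(\<lambda>x. \<integral>y. f y \<partial>P x) \<in> borel_measurable borel"
  using measurable_compose[OF P_subprob_meas integral_measurable_subprob_algebra[OF assms]] .

lemma integral_bind_P:
  fixes f :: "'a \<Rightarrow> real"
  assumes "\<mu> \<in> space (prob_algebra borel)" "f \<in> borel_measurable borel" "\<And>y. \<bar>f y\<bar> \<le> M"
  shows "(\<integral>y. f y \<partial>(\<mu> \<bind> P)) = (\<integral>x. \<integral>y. f y \<partial>P x \<partial>\<mu>)"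
proof (rule integral_bind[where K = borel and B = M and B' = 1])
  have \<mu>: "prob_space \<mu>" "sets \<mu> = sets borel" using assms(1) by (auto simp: space_prob_algebra)
  show "P \<in> \<mu> \<rightarrow>\<^sub>M subprob_algebra borel"
    using P_subprob_meas by (simp add: measurable_cong_sets[OF \<mu>(2) refl])
  show "finite_measure \<mu>" using \<mu>(1) by (rule prob_space.finite_measure)
  show "AE x in \<mu>. emeasure (P x) (space (P x)) \<le> ennreal 1"
    using prob_space.emeasure_space_1[OF P_prob] by simp
qed (use assms in auto)

text \<open>The local Lipschitz constant enters through a Borel majorant \<open>G\<close>, so that the integral over
  \<open>P x\<close> is used only through its monotonicity.\<close>

lemma slope_P_power2_le:
  assumes "\<And>y. (slope (lip_fun f) y)\<^sup>2 \<le> ennreal (G y)" "integrable (P x) G" "\<And>y. 0 \<le> G y"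
  shows "(slope (\<lambda>z. \<integral>y. lip_fun f y \<partial>P z) x)\<^sup>2 \<le> ennreal (C * (\<integral>y. G y \<partial>P x))"
proof -
  have "(\<integral>\<^sup>+y. (slope (lip_fun f) y)\<^sup>2 \<partial>P x) \<le> (\<integral>\<^sup>+y. ennreal (G y) \<partial>P x)"
    using assms(1) by (intro nn_integral_mono)
  also have "\<dots> = ennreal (\<integral>y. G y \<partial>P x)"
    using assms by (intro nn_integral_eq_integral) auto
  finally have "ennreal C * (\<integral>\<^sup>+y. (slope (lip_fun f) y)\<^sup>2 \<partial>P x) \<le> ennreal C * ennreal (\<integral>y. G y \<partial>P x)"
    by (intro mult_left_mono) auto
  also have "\<dots> = ennreal (C * (\<integral>y. G y \<partial>P x))"
    using C_nonneg assms(3) by (simp add: ennreal_mult integral_nonneg)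
  finally show ?thesis
    using grad[of f x] by (rule order_trans[rotated])
qed

lemma slope_P_le:
  assumes "\<And>y. slope (lip_fun f) y \<le> ennreal L" "0 \<le> L"
  shows "slope (\<lambda>z. \<integral>y. lip_fun f y \<partial>P z) x \<le> ennreal (sqrt C * L)"
proof (rule ennreal_power2_le_imp_le)
  interpret prob_space "P x" by (rule P_prob)
  have "(slope (lip_fun f) y)\<^sup>2 \<le> ennreal (L\<^sup>2)" for y
    using assms by (metis ennreal_power power_mono zero_le)
  from slope_P_power2_le[OF this, where x = x]
  show "(slope (\<lambda>z. \<integral>y. lip_fun f y \<partial>P z) x)\<^sup>2 \<le> ennreal ((sqrt C * L)\<^sup>2)"
    using C_nonneg by (simp add: power_mult_distrib prob_space)
qed (use assms C_nonneg in auto)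

lemma lipschitz_P:
  assumes "\<And>y. slope (lip_fun f) y \<le> ennreal L" "0 \<le> L"
  shows "(sqrt C * L)-lipschitz_on UNIV (\<lambda>z. \<integral>y. lip_fun f y \<partial>P z)"
  using assms C_nonneg by (intro length_space_lipschitz length slope_P_le) auto

definition P_lip :: "'a lip_b \<Rightarrow> 'a lip_b" where
  "P_lip f = Lip_b (\<lambda>z. \<integral>y. lip_fun f y \<partial>P z)"

lemma lip_fun_P_lip: "lip_fun (P_lip f) = (\<lambda>z. \<integral>y. lip_fun f y \<partial>P z)"
  unfolding P_lip_def
proof (rule Lip_b_inverse, safe)
  show "bounded (range (\<lambda>z. \<integral>y. lip_fun f y \<partial>P z))"
    using P_integral_bound[OF borel_measurable_lip_fun sup_norm_upper[OF bounded_lip_fun]]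
    by (auto simp: bounded_iff)
  show "\<exists>L. L-lipschitz_on UNIV (\<lambda>z. \<integral>y. lip_fun f y \<partial>P z)"
    using lipschitz_P[OF slope_lip_fun_le lipschitz_on_nonneg[OF lipschitz_lip_fun]] by blast
qed

lemma P_integrable_lip: "integrable (P x) (lip_fun f)"
  by (rule P_integrable[OF borel_measurable_lip_fun sup_norm_upper[OF bounded_lip_fun]])

lemma bounded_linear_P_lip: "bounded_linear P_lip"
proof (rule bounded_linear_intro[where K = "1 + sqrt C"])
  show "P_lip (f + g) = P_lip f + P_lip g" for f g
    by (simp add: lip_fun_inject[symmetric] lip_fun_P_lip plus_lip_b.rep_eq P_integrable_lip)
  show "P_lip (r *\<^sub>R f) = r *\<^sub>R P_lip f" for r f
    by (simp add: lip_fun_inject[symmetric] lip_fun_P_lip scaleR_lip_b.rep_eq)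
  fix f
  have "sup_norm (lip_fun (P_lip f)) \<le> sup_norm (lip_fun f)"
    unfolding lip_fun_P_lip
    by (intro sup_norm_least P_integral_bound borel_measurable_lip_fun sup_norm_upper[OF bounded_lip_fun])
  moreover have "lip_const (lip_fun (P_lip f)) \<le> sqrt C * lip_const (lip_fun f)"
    unfolding lip_fun_P_lip
    by (intro lip_const_le lipschitz_P slope_lip_fun_le lipschitz_on_nonneg[OF lipschitz_lip_fun])
  moreover have "0 \<le> sqrt C * sup_norm (lip_fun f)" "0 \<le> lip_const (lip_fun f)"
    using C_nonneg sup_norm_nonneg[of f] lipschitz_on_nonneg[OF lipschitz_lip_fun, of f] by auto
  ultimately show "norm (P_lip f) \<le> norm f * (1 + sqrt C)"
    unfolding norm_lip_b_def by (simp add: algebra_simps)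
qed

text \<open>Integrate the differential inequality for \<open>\<phi>\<close> against \<open>P x\<close>. The time derivative commutes
  with the bounded operator \<open>P_lip\<close>, the gradient estimate turns \<open>C P(\<bar>\<nabla>\<phi>\<bar>\<^sup>2)\<close> into
  \<open>\<bar>\<nabla>P\<phi>\<bar>\<^sup>2\<close>, and the zero-order term is treated by \<open>(P\<phi>)\<^sup>2 \<le> P(\<phi>\<^sup>2)\<close>.\<close>

lemma HJ_class_P_lip:
  assumes b: "0 \<le> b" and \<phi>: "\<phi> \<in> HJ_class C b"
  shows "(\<lambda>s. P_lip (\<phi> s)) \<in> HJ_class 1 b"
proof -
  from \<phi> obtain \<psi> where cont: "continuous_on {0..1} \<psi>"
    and deriv: "\<And>s. s \<in> {0..1} \<Longrightarrow> (\<phi> has_vector_derivative \<psi> s) (at s within {0..1})"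
    and HJ: "\<And>s x. s \<in> {0..1} \<Longrightarrow> lip_fun (\<psi> s) x + C * (enn2real (slope (lip_fun (\<phi> s)) x))\<^sup>2
           + b * (lip_fun (\<phi> s) x)\<^sup>2 \<le> 0"
    unfolding HJ_class_def by auto
  show ?thesis unfolding HJ_class_def
  proof (intro CollectI exI[of _ "\<lambda>s. P_lip (\<psi> s)"] conjI ballI allI)
    show "continuous_on {0..1} (\<lambda>s. P_lip (\<psi> s))"
      by (rule bounded_linear.continuous_on[OF bounded_linear_P_lip cont])
    fix s :: real assume s: "s \<in> {0..1}"
    show "((\<lambda>s. P_lip (\<phi> s)) has_vector_derivative P_lip (\<psi> s)) (at s within {0..1})"
      by (rule bounded_linear.has_vector_derivative[OF bounded_linear_P_lip deriv[OF s]])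
    fix x
    interpret prob_space "P x" by (rule P_prob)
    let ?f = "lip_fun (\<phi> s)" and ?h = "lip_fun (\<psi> s)"
    have sq: "integrable (P x) (\<lambda>y. (?f y)\<^sup>2)"
    proof (rule P_integrable)
      show "(\<lambda>y. (?f y)\<^sup>2) \<in> borel_measurable borel"
        using borel_measurable_lip_fun by (rule borel_measurable_power)
      show "\<bar>(?f y)\<^sup>2\<bar> \<le> (sup_norm ?f)\<^sup>2" for y
        using sup_norm_upper[OF bounded_lip_fun, of "\<phi> s" y] by (simp add: abs_le_square_iff[symmetric])
    qed
    \<comment> \<open>The differential inequality itself supplies a Borel majorant of \<open>C \<bar>\<nabla>\<phi>\<bar>\<^sup>2\<close>.\<close>
    define G where "G y = - ?h y - b * (?f y)\<^sup>2" for y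
    have G_int: "integrable (P x) G"
      unfolding G_def using sq by (intro Bochner_Integration.integrable_diff integrable_mult_right
        Bochner_Integration.integrable_minus P_integrable_lip) auto
    have G_ge: "C * (enn2real (slope ?f y))\<^sup>2 \<le> G y" for y
      using HJ[OF s, of y] by (simp add: G_def)
    then have G_nonneg: "0 \<le> G y" for y
      using C_nonneg by (smt (verit) mult_nonneg_nonneg zero_le_power2)
    have "(slope (lip_fun (P_lip (\<phi> s))) x)\<^sup>2 \<le> ennreal (\<integral>y. G y \<partial>P x)"
    proof (cases "C = 0")
      case True
      then show ?thesis using grad[of "\<phi> s" x] by (simp add: lip_fun_P_lip)
    next
      case False
      then have C: "0 < C" using C_nonneg by simp
      have "(slope ?f y)\<^sup>2 \<le> ennreal (G y / C)" for y
      proof -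
        have "(slope ?f y)\<^sup>2 = ennreal ((enn2real (slope ?f y))\<^sup>2)"
          using slope_lip_fun_finite[of "\<phi> s" y] by (simp add: ennreal_power[symmetric])
        also have "\<dots> \<le> ennreal (G y / C)"
          using G_ge[of y] C by (intro ennreal_leI) (simp add: field_simps)
        finally show ?thesis .
      qed
      from slope_P_power2_le[OF this] show ?thesis
        using C G_int G_nonneg by (simp add: lip_fun_P_lip)
    qed
    moreover have "(slope (lip_fun (P_lip (\<phi> s))) x)\<^sup>2 = ennreal ((enn2real (slope (lip_fun (P_lip (\<phi> s))) x))\<^sup>2)"
      using slope_lip_fun_finite[of "P_lip (\<phi> s)" x] by (simp add: ennreal_power[symmetric])
    ultimately have "(enn2real (slope (lip_fun (P_lip (\<phi> s))) x))\<^sup>2 \<le> (\<integral>y. G y \<partial>P x)"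
      by (simp add: integral_nonneg G_nonneg)
    also have "(\<integral>y. G y \<partial>P x) = - (\<integral>y. ?h y \<partial>P x) - b * (\<integral>y. (?f y)\<^sup>2 \<partial>P x)"
      unfolding G_def using sq by (simp add: P_integrable_lip)
    finally have "(enn2real (slope (lip_fun (P_lip (\<phi> s))) x))\<^sup>2
        \<le> - (\<integral>y. ?h y \<partial>P x) - b * (\<integral>y. (?f y)\<^sup>2 \<partial>P x)" .
    moreover have "b * (\<integral>y. ?f y \<partial>P x)\<^sup>2 \<le> b * (\<integral>y. (?f y)\<^sup>2 \<partial>P x)"
      using variance_positive[of ?f] variance_eq[OF P_integrable_lip sq] b by (intro mult_left_mono) auto
    ultimately show "lip_fun (P_lip (\<psi> s)) x + 1 * (enn2real (slope (lip_fun (P_lip (\<phi> s))) x))\<^sup>2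
           + b * (lip_fun (P_lip (\<phi> s)) x)\<^sup>2 \<le> 0"
      by (simp add: lip_fun_P_lip)
  qed
qed

theorem HJ_cost_bind_le:
  fixes \<mu>\<^sub>0 \<mu>\<^sub>1 :: "'a measure"
  assumes "0 \<le> b" "\<mu>\<^sub>0 \<in> space (prob_algebra borel)" "\<mu>\<^sub>1 \<in> space (prob_algebra borel)"
  shows "HJ_cost C b (\<mu>\<^sub>0 \<bind> P) (\<mu>\<^sub>1 \<bind> P) \<le> HJ_cost 1 b \<mu>\<^sub>0 \<mu>\<^sub>1"
  unfolding HJ_cost_def
proof (rule SUP_least)
  fix \<phi> :: "real \<Rightarrow> 'a lip_b" assume "\<phi> \<in> HJ_class C b"
  then have "(\<lambda>s. P_lip (\<phi> s)) \<in> HJ_class 1 b" by (rule HJ_class_P_lip[OF assms(1)])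
  moreover have "(\<integral>x. lip_fun (\<phi> s) x \<partial>(\<mu> \<bind> P)) = (\<integral>x. lip_fun (P_lip (\<phi> s)) x \<partial>\<mu>)"
    if "\<mu> \<in> space (prob_algebra borel)" for s and \<mu> :: "'a measure"
    unfolding lip_fun_P_lip
    by (rule integral_bind_P[OF that borel_measurable_lip_fun sup_norm_upper[OF bounded_lip_fun]])
  ultimately show "ereal ((\<integral>x. lip_fun (\<phi> 1) x \<partial>(\<mu>\<^sub>1 \<bind> P)) - (\<integral>x. lip_fun (\<phi> 0) x \<partial>(\<mu>\<^sub>0 \<bind> P)))
    \<le> (SUP \<phi> \<in> HJ_class 1 b. ereal ((\<integral>x. lip_fun (\<phi> 1) x \<partial>\<mu>\<^sub>1) - (\<integral>x. lip_fun (\<phi> 0) x \<partial>\<mu>\<^sub>0)))"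
    using assms by (intro SUP_upper2) auto
qed

end

section \<open>The Hopf--Lax semigroup\<close>

text \<open>With the scaling \<open>d\<^sup>2/s\<close>, time \<open>1\<close> is the transform dual to the cost \<open>d\<^sup>2\<close>, and the
  Hamilton--Jacobi equation reads \<open>\<partial>\<^sub>s Q + (1/4) \<bar>\<nabla>Q\<bar>\<^sup>2 = 0\<close>.\<close>

definition hopf_lax :: "('a::metric_space \<Rightarrow> real) \<Rightarrow> real \<Rightarrow> 'a \<Rightarrow> real" where
  "hopf_lax f s x = (INF z. f z + (dist x z)\<^sup>2 / s)"

locale bounded_function =
  fixes f :: "'a::metric_space \<Rightarrow> real" and M :: real
  assumes bound: "\<And>z. \<bar>f z\<bar> \<le> M"
begin

lemma M_nonneg: "0 \<le> M"
  using bound[of undefined] by linarith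

lemma hopf_lax_le:
  assumes "0 < s" shows "hopf_lax f s x \<le> f z + (dist x z)\<^sup>2 / s"
  unfolding hopf_lax_def
proof (rule cINF_lower)
  have "- M \<le> f z + (dist x z)\<^sup>2 / s" for z
    using bound[of z] assms by (smt (verit) divide_nonneg_pos zero_le_power2)
  then show "bdd_below (range (\<lambda>z. f z + (dist x z)\<^sup>2 / s))" by (rule bdd_belowI2)
qed simp

lemma hopf_lax_ge:
  assumes "\<And>z. c \<le> f z + (dist x z)\<^sup>2 / s" shows "c \<le> hopf_lax f s x"
  unfolding hopf_lax_def using assms by (intro cINF_greatest) auto

lemma hopf_lax_le_self: "0 < s \<Longrightarrow> hopf_lax f s x \<le> f x"
  using hopf_lax_le[of s x x] by simp

lemma abs_hopf_lax_le:
  assumes "0 < s" shows "\<bar>hopf_lax f s x\<bar> \<le> M"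
proof -
  have "- M \<le> hopf_lax f s x"
    using bound assms by (intro hopf_lax_ge) (smt (verit) divide_nonneg_pos zero_le_power2)
  then show ?thesis using hopf_lax_le_self[OF assms, of x] bound[of x] by linarith
qed

lemma hopf_lax_antimono:
  assumes "0 < s" "s \<le> t" shows "hopf_lax f t x \<le> hopf_lax f s x"
proof (rule hopf_lax_ge)
  fix z
  have "hopf_lax f t x \<le> f z + (dist x z)\<^sup>2 / t" using assms by (intro hopf_lax_le) simp
  also have "\<dots> \<le> f z + (dist x z)\<^sup>2 / s" using assms by (intro add_left_mono divide_left_mono) auto
  finally show "hopf_lax f t x \<le> f z + (dist x z)\<^sup>2 / s" .
qed

lemma hopf_lax_near_minimizer:
  assumes "0 < \<tau>" obtains z where "f z + (dist x z)\<^sup>2 / s < hopf_lax f s x + \<tau>"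
proof -
  have "\<not> (\<forall>z. hopf_lax f s x + \<tau> \<le> f z + (dist x z)\<^sup>2 / s)"
    using hopf_lax_ge[of "hopf_lax f s x + \<tau>" x s] assms by auto
  then show thesis using that by (auto simp: not_le)
qed

text \<open>A near-minimizer \<open>z\<close> at time \<open>s\<close> is a competitor at time \<open>t\<close>, where it costs
  \<open>(1/s - 1/t) d(y,z)\<^sup>2\<close> less. The decrease of the semigroup on \<open>[s,t]\<close> therefore bounds
  \<open>d(y,z)\<close>, and \<open>d(y,z)\<close> bounds the increments at time \<open>s\<close>.\<close>

lemma hopf_lax_increment:
  assumes s: "0 < s" and t: "s < t"
  shows "hopf_lax f s x - hopf_lax f s y \<le> dist x y *
    (2 * sqrt ((hopf_lax f s y - hopf_lax f t y) / (1 / s - 1 / t)) + dist x y) / s"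
proof -
  define A where "A = hopf_lax f s y - hopf_lax f t y"
  define \<kappa> where "\<kappa> = 1 / s - 1 / t"
  define d where "d = dist x y"
  have \<kappa>: "0 < \<kappa>" using s t by (simp add: \<kappa>_def field_simps)
  have near: "hopf_lax f s x - hopf_lax f s y \<le> \<tau> + d * (2 * sqrt ((A + \<tau>) / \<kappa>) + d) / s"
    if \<tau>: "0 < \<tau>" for \<tau>
  proof -
    obtain z where z: "f z + (dist y z)\<^sup>2 / s < hopf_lax f s y + \<tau>"
      using hopf_lax_near_minimizer[OF \<tau>] .
    have "\<kappa> * (dist y z)\<^sup>2 = (f z + (dist y z)\<^sup>2 / s) - (f z + (dist y z)\<^sup>2 / t)"
      by (simp add: \<kappa>_def algebra_simps)
    also have "\<dots> \<le> A + \<tau>"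
      using z hopf_lax_le[of t y z] s t by (simp add: A_def)
    finally have "(dist y z)\<^sup>2 \<le> (A + \<tau>) / \<kappa>" using \<kappa> by (simp add: field_simps)
    then have r: "dist y z \<le> sqrt ((A + \<tau>) / \<kappa>)" by (rule real_le_rsqrt)
    have "dist x z \<le> d + dist y z" unfolding d_def by (rule dist_triangle)
    then have "(dist x z)\<^sup>2 \<le> (d + dist y z)\<^sup>2" by (intro power_mono) auto
    then have "(dist x z)\<^sup>2 - (dist y z)\<^sup>2 \<le> d * (2 * dist y z + d)"
      by (simp add: power2_eq_square algebra_simps)
    also have "\<dots> \<le> d * (2 * sqrt ((A + \<tau>) / \<kappa>) + d)"
      using r by (intro mult_left_mono) (auto simp: d_def)
    finally have "((dist x z)\<^sup>2 - (dist y z)\<^sup>2) / s \<le> d * (2 * sqrt ((A + \<tau>) / \<kappa>) + d) / s"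
      using s by (intro divide_right_mono) auto
    moreover have "hopf_lax f s x \<le> f z + (dist x z)\<^sup>2 / s" by (rule hopf_lax_le[OF s])
    ultimately show ?thesis using z by (simp add: diff_divide_distrib)
  qed
  have "((\<lambda>\<tau>. \<tau> + d * (2 * sqrt ((A + \<tau>) / \<kappa>) + d) / s) \<longlongrightarrow>
      0 + d * (2 * sqrt ((A + 0) / \<kappa>) + d) / s) (at_right 0)"
    using \<kappa> s by (intro tendsto_intros) auto
  then have "hopf_lax f s x - hopf_lax f s y \<le> 0 + d * (2 * sqrt ((A + 0) / \<kappa>) + d) / s"
    by (rule tendsto_lowerbound) (auto simp: eventually_at_right_less intro!: eventually_at_rightI[of 0 1] near)
  then show ?thesis by (simp add: A_def \<kappa>_def d_def)
qed

text \<open>For \<open>d(x,y) \<le> 1\<close> the increment bound applies, with \<open>t = 2 s\<close> as an arbitrary later time; for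
  larger distances the bound \<open>M\<close> on the function suffices.\<close>

lemma hopf_lax_lipschitz:
  assumes s: "0 < s" shows "\<exists>L. L-lipschitz_on UNIV (hopf_lax f s)"
proof -
  define B where "B = sqrt (2 * M / (1 / s - 1 / (2 * s)))"
  define L where "L = (2 * B + 1) / s + 2 * M"
  have B: "0 \<le> B" using s M_nonneg by (simp add: B_def field_simps)
  have L: "0 \<le> L" using s M_nonneg B by (simp add: L_def)
  have le: "hopf_lax f s x - hopf_lax f s y \<le> L * dist x y" for x y
  proof (cases "dist x y \<le> 1")
    case True
    have "hopf_lax f s x - hopf_lax f s y \<le> dist x y *
      (2 * sqrt ((hopf_lax f s y - hopf_lax f (2 * s) y) / (1 / s - 1 / (2 * s))) + dist x y) / s"
      using s by (intro hopf_lax_increment) auto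
    also have "\<dots> \<le> dist x y * (2 * B + 1) / s"
    proof -
      have "hopf_lax f s y - hopf_lax f (2 * s) y \<le> 2 * M"
        using abs_hopf_lax_le[of s y] abs_hopf_lax_le[of "2 * s" y] s by (simp add: abs_le_iff)
      then have "sqrt ((hopf_lax f s y - hopf_lax f (2 * s) y) / (1 / s - 1 / (2 * s))) \<le> B"
        unfolding B_def using s by (intro real_sqrt_le_mono divide_right_mono) (auto simp: field_simps)
      then show ?thesis using True s by (intro divide_right_mono mult_left_mono) auto
    qed
    also have "\<dots> \<le> L * dist x y" using M_nonneg by (simp add: L_def algebra_simps)
    finally show ?thesis .
  next
    case False
    have "hopf_lax f s x - hopf_lax f s y \<le> 2 * M"
      using abs_hopf_lax_le[of s x] abs_hopf_lax_le[of s y] s by (simp add: abs_le_iff)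
    also have "\<dots> \<le> L * 1" using B s by (simp add: L_def)
    also have "\<dots> \<le> L * dist x y" using False L by (intro mult_left_mono) auto
    finally show ?thesis .
  qed
  have "L-lipschitz_on UNIV (hopf_lax f s)"
  proof (rule lipschitz_onI[OF _ L])
    show "dist (hopf_lax f s x) (hopf_lax f s y) \<le> L * dist x y" for x y
      using le[of x y] le[of y x] by (simp add: dist_real_def abs_le_iff dist_commute)
  qed
  then show ?thesis ..
qed

lemma lip_fun_Lip_b_hopf_lax:
  assumes s: "0 < s" shows "lip_fun (Lip_b (hopf_lax f s)) = hopf_lax f s"
proof (rule Lip_b_inverse, safe)
  show "bounded (range (hopf_lax f s))"
    using abs_hopf_lax_le[OF s] unfolding bounded_iff by auto
qed (rule hopf_lax_lipschitz[OF s])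

text \<open>A finite-difference form of the subsolution property
  \<open>\<partial>\<^sub>s Q + (1/4) \<bar>\<nabla>Q\<bar>\<^sup>2 \<le> 0\<close> of \<open>Q\<^sub>s = hopf_lax f s\<close>; the factor \<open>t/s\<close> tends to \<open>1\<close> as \<open>t \<rightarrow> s\<close>.\<close>

lemma slope_hopf_lax_le:
  assumes s: "0 < s" and t: "s < t"
  shows "(slope (hopf_lax f s) x)\<^sup>2 \<le>
    ennreal (4 * t / (s * (t - s)) * (hopf_lax f s x - hopf_lax f t x))"
proof -
  define \<kappa> where "\<kappa> = 1 / s - 1 / t"
  define F where "F y = 2 * sqrt ((hopf_lax f s y - hopf_lax f t y) / \<kappa>) / s" for y
  have \<kappa>: "0 < \<kappa>" using s t by (simp add: \<kappa>_def field_simps)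
  have cont: "isCont (hopf_lax f r) x" if "0 < r" for r
    using hopf_lax_lipschitz[OF that] lipschitz_on_continuous_on continuous_on_eq_continuous_at open_UNIV
    by blast
  have A_nonneg: "0 \<le> hopf_lax f s x - hopf_lax f t x" using hopf_lax_antimono[of s t x] s t by simp
  have F_nonneg: "0 \<le> F x" using A_nonneg \<kappa> s by (simp add: F_def)
  have inc: "hopf_lax f s y - hopf_lax f s z \<le> dist y z * (F z + dist y z / s)" for y z
    using hopf_lax_increment[OF s t, of y z] by (simp add: F_def \<kappa>_def add_divide_distrib[symmetric])
  have "slope (hopf_lax f s) x \<le> ennreal (F x)"
  proof (rule slope_leI[OF F_nonneg])
    fix \<theta> :: real assume \<theta>: "0 < \<theta>"
    have "isCont (\<lambda>y. F y + dist x y / s) x"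
      unfolding F_def using \<kappa> s t cont[OF s] cont[of t] by (intro continuous_intros) auto
    then have "((\<lambda>y. F y + dist x y / s) \<longlongrightarrow> F x + dist x x / s) (nhds x)"
      unfolding isCont_def by (subst (asm) tendsto_at_iff_tendsto_nhds)
    then have "\<forall>\<^sub>F y in nhds x. F y + dist x y / s < F x + \<theta>"
      by (rule order_tendstoD) (use \<theta> in simp)
    moreover have "\<forall>\<^sub>F y in nhds x. F x + dist x y / s < F x + \<theta>"
    proof (rule order_tendstoD)
      show "((\<lambda>y. F x + dist x y / s) \<longlongrightarrow> F x + dist x x / s) (nhds x)"
        using s by (intro tendsto_intros filterlim_ident) auto
    qed (use \<theta> in simp)
    ultimately have "\<forall>\<^sub>F y in nhds x. F y + dist x y / s < F x + \<theta> \<and> F x + dist x y / s < F x + \<theta>"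
      by (rule eventually_conj)
    then obtain r where r: "0 < r" "\<And>y. dist y x < r \<Longrightarrow>
        F y + dist x y / s < F x + \<theta> \<and> F x + dist x y / s < F x + \<theta>"
      unfolding eventually_nhds_metric by blast
    have "\<bar>hopf_lax f s x - hopf_lax f s y\<bar> \<le> (F x + \<theta>) * dist x y" if "dist x y \<le> r / 2" for y
    proof -
      have "dist y x < r" using that r(1) by (simp add: dist_commute)
      note near = r(2)[OF this]
      have "hopf_lax f s x - hopf_lax f s y \<le> dist x y * (F x + \<theta>)"
        using near by (intro order_trans[OF inc mult_left_mono]) auto
      moreover have "hopf_lax f s y - hopf_lax f s x \<le> dist x y * (F x + \<theta>)"
        using near by (intro order_trans[OF inc[of y x, unfolded dist_commute[of y x]] mult_left_mono]) auto
      ultimately show ?thesis by (simp add: abs_le_iff mult.commute)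
    qed
    then show "\<exists>r>0. \<forall>y. dist x y \<le> r \<longrightarrow> \<bar>hopf_lax f s x - hopf_lax f s y\<bar> \<le> (F x + \<theta>) * dist x y"
      using r(1) by (intro exI[of _ "r / 2"]) auto
  qed
  then have "(slope (hopf_lax f s) x)\<^sup>2 \<le> ennreal ((F x)\<^sup>2)"
    using F_nonneg by (metis ennreal_power power_mono zero_le)
  also have "(F x)\<^sup>2 = 4 * ((hopf_lax f s x - hopf_lax f t x) / \<kappa>) / s\<^sup>2"
    using A_nonneg \<kappa> by (simp add: F_def power_divide power_mult_distrib)
  also have "\<dots> = 4 * t / (s * (t - s)) * (hopf_lax f s x - hopf_lax f t x)"
    using s t by (simp add: \<kappa>_def divide_simps power2_eq_square)
  finally show ?thesis .
qed

lemma slope_hopf_lax_le_sqrt: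
  assumes s: "0 < s"
  shows "slope (hopf_lax f s) x \<le> ennreal (4 * sqrt (M / s))"
proof (rule ennreal_power2_le_imp_le)
  have "(slope (hopf_lax f s) x)\<^sup>2 \<le>
      ennreal (4 * (2 * s) / (s * (2 * s - s)) * (hopf_lax f s x - hopf_lax f (2 * s) x))"
    using s by (intro slope_hopf_lax_le) auto
  also have "\<dots> \<le> ennreal (4 * (2 * s) / (s * (2 * s - s)) * (2 * M))"
    using abs_hopf_lax_le[of s x] abs_hopf_lax_le[of "2 * s" x] s
    by (intro ennreal_leI mult_left_mono) (auto simp: abs_le_iff)
  also have "4 * (2 * s) / (s * (2 * s - s)) * (2 * M) = (4 * sqrt (M / s))\<^sup>2"
    using s M_nonneg by (simp add: power_mult_distrib field_simps)
  finally show "(slope (hopf_lax f s) x)\<^sup>2 \<le> ennreal ((4 * sqrt (M / s))\<^sup>2)" .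
qed (use s M_nonneg in auto)

end

section \<open>Contraction of dual potentials\<close>

lemma slope_add_le:
  assumes "slope f x \<le> ennreal S" "slope g x \<le> ennreal T" "0 \<le> S" "0 \<le> T"
  shows "slope (\<lambda>y. f y + g y) x \<le> ennreal (S + T)"
proof (rule slope_leI)
  fix \<theta> :: real assume "0 < \<theta>"
  then have S: "S < S + \<theta> / 2" and T: "T < T + \<theta> / 2" by auto
  obtain r where r: "0 < r" "\<And>y. dist x y \<le> r \<Longrightarrow> \<bar>f x - f y\<bar> \<le> (S + \<theta> / 2) * dist x y"
    using slope_leD[OF assms(1,3) S] by metis
  obtain r' where r': "0 < r'" "\<And>y. dist x y \<le> r' \<Longrightarrow> \<bar>g x - g y\<bar> \<le> (T + \<theta> / 2) * dist x y"
    using slope_leD[OF assms(2,4) T] by metis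
  have "\<bar>f x + g x - (f y + g y)\<bar> \<le> (S + T + \<theta>) * dist x y" if "dist x y \<le> min r r'" for y
  proof -
    have "\<bar>f x + g x - (f y + g y)\<bar> \<le> \<bar>f x - f y\<bar> + \<bar>g x - g y\<bar>" by linarith
    also have "\<dots> \<le> (S + \<theta> / 2) * dist x y + (T + \<theta> / 2) * dist x y"
      using that by (intro add_mono r r') auto
    also have "\<dots> = (S + T + \<theta>) * dist x y" by (simp add: algebra_simps)
    finally show ?thesis .
  qed
  then show "\<exists>r>0. \<forall>y. dist x y \<le> r \<longrightarrow> \<bar>f x + g x - (f y + g y)\<bar> \<le> (S + T + \<theta>) * dist x y"
    using r(1) r'(1) by (intro exI[of _ "min r r'"]) auto
qed (use assms in auto)

lemma slope_sum_le:
  assumes "finite I" "\<And>i. i \<in> I \<Longrightarrow> slope (f i) x \<le> ennreal (S i)" "\<And>i. i \<in> I \<Longrightarrow> 0 \<le> S i"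
  shows "slope (\<lambda>y. \<Sum>i\<in>I. f i y) x \<le> ennreal (\<Sum>i\<in>I. S i)"
  using assms
proof (induction I rule: finite_induct)
  case empty
  show ?case by (rule slope_leI) (auto intro: exI[of _ 1])
next
  case (insert i I)
  have "slope (\<lambda>y. f i y + (\<Sum>j\<in>I. f j y)) x \<le> ennreal (S i + (\<Sum>j\<in>I. S j))"
    using insert by (intro slope_add_le sum_nonneg) auto
  then show ?case using insert by simp
qed

lemma slope_cmult_le:
  assumes "slope f x \<le> ennreal S" "0 \<le> S" "0 < c"
  shows "slope (\<lambda>y. c * f y) x \<le> ennreal (c * S)"
proof (rule slope_leI)
  fix \<theta> :: real assume "0 < \<theta>"
  then have S: "S < S + \<theta> / c" using assms by auto
  obtain r where r: "0 < r" "\<And>y. dist x y \<le> r \<Longrightarrow> \<bar>f x - f y\<bar> \<le> (S + \<theta> / c) * dist x y"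
    using slope_leD[OF assms(1,2) S] by metis
  have "\<bar>c * f x - c * f y\<bar> \<le> (c * S + \<theta>) * dist x y" if "dist x y \<le> r" for y
  proof -
    have "\<bar>c * f x - c * f y\<bar> = c * \<bar>f x - f y\<bar>"
      using assms(3) by (simp add: right_diff_distrib[symmetric] abs_mult)
    also have "\<dots> \<le> c * ((S + \<theta> / c) * dist x y)" using assms(3) r(2)[OF that] by simp
    also have "\<dots> = (c * S + \<theta>) * dist x y" using assms(3) by (simp add: field_simps)
    finally show ?thesis .
  qed
  then show "\<exists>r>0. \<forall>y. dist x y \<le> r \<longrightarrow> \<bar>c * f x - c * f y\<bar> \<le> (c * S + \<theta>) * dist x y"
    using r(1) by auto
qed (use assms in auto)

text \<open>One time step, from \<open>w\<close> to \<open>v\<close>, of a discrete Hamilton--Jacobi subsolution. Let \<open>R\<close> bound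
  \<open>w - v\<close> on the ball of radius \<open>\<l>\<close> around \<open>y\<close>. Then \<open>w\<close> increases by at most \<open>\<surd>(c R) \<l>\<close> from \<open>x\<close>
  to \<open>y\<close>, while \<open>v\<close> lies below \<open>w\<close> by \<open>R - e \<l>\<close> at \<open>y\<close>; the worst \<open>R\<close> gives \<open>c \<l>\<^sup>2 / 4\<close>. The
  constant \<open>e\<close> measures how far the decrease \<open>w - v\<close> at \<open>y\<close> can be from the decrease at the
  points of the path where the growth of \<open>w\<close> is spent.\<close>

lemma hamilton_jacobi_step:
  fixes v w :: "'a::metric_space \<Rightarrow> real"
  assumes len: "length_space (UNIV :: 'a set)" and xy: "dist x y < \<l>"
    and c: "0 \<le> c" and e: "0 \<le> e"
    and slope: "\<And>z. slope w z \<le> ennreal (sqrt (c * (w z - v z)))"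
    and le: "\<And>z. v z \<le> w z"
    and lip: "e-lipschitz_on UNIV (\<lambda>z. w z - v z)"
  shows "v y - w x \<le> c * \<l>\<^sup>2 / 4 + e * \<l>"
proof -
  define R where "R = w y - v y + e * \<l>"
  have l: "0 < \<l>" using xy zero_le_dist[of x y] by linarith
  have R: "0 \<le> R" using le[of y] e l by (simp add: R_def)
  have "\<bar>w y - w x\<bar> \<le> sqrt (c * R) * \<l>"
  proof (rule length_space_mean_value[OF len xy])
    fix z assume z: "dist z y < \<l>"
    have "(w z - v z) - (w y - v y) \<le> e * dist z y"
      using lipschitz_onD[OF lip, of z y] by (simp add: dist_real_def)
    also have "\<dots> \<le> e * \<l>" using z e by (intro mult_left_mono) auto
    finally have "w z - v z \<le> R" by (simp add: R_def)
    then have "sqrt (c * (w z - v z)) \<le> sqrt (c * R)"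
      using c by (intro real_sqrt_le_mono mult_left_mono)
    then show "slope w z \<le> ennreal (sqrt (c * R))"
      using slope[of z] ennreal_leI order_trans by blast
  qed (use c R in auto)
  moreover have "sqrt (c * R) * \<l> \<le> R + c * \<l>\<^sup>2 / 4"
  proof -
    have "0 \<le> (sqrt R - sqrt c * \<l> / 2)\<^sup>2" by simp
    also have "\<dots> = R + c * \<l>\<^sup>2 / 4 - sqrt (c * R) * \<l>"
      using R c by (simp add: power2_diff power_mult_distrib power_divide real_sqrt_mult)
    finally show ?thesis by simp
  qed
  ultimately show ?thesis by (simp add: R_def)
qed

lemma hamilton_jacobi_iterate:
  fixes w :: "nat \<Rightarrow> 'a::metric_space \<Rightarrow> real"
  assumes len: "length_space (UNIV :: 'a set)"
    and c: "0 \<le> c" and e: "0 \<le> e" and l: "0 < \<l>"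
    and slope: "\<And>k z. slope (w k) z \<le> ennreal (sqrt (c * (w k z - w (Suc k) z)))"
    and le: "\<And>k z. w (Suc k) z \<le> w k z"
    and lip: "\<And>k. e-lipschitz_on UNIV (\<lambda>z. w k z - w (Suc k) z)"
    and xy: "dist x y < real n * \<l>"
  shows "w n y - w 0 x \<le> real n * (c * \<l>\<^sup>2 / 4 + e * \<l>)"
  using xy
proof (induction n arbitrary: y)
  case (Suc n)
  have step: "w (Suc n) y - w n z \<le> c * \<l>\<^sup>2 / 4 + e * \<l>" if "dist z y < \<l>" for z
    using that by (rule hamilton_jacobi_step[OF len _ c e slope le lip])
  show ?case
  proof (cases "n = 0")
    case True
    then show ?thesis using Suc.prems step[of x] by simp
  next
    case False
    have "dist x y < real n * \<l> + \<l>" using Suc.prems by (simp add: distrib_right add.commute)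
    then obtain z where z: "dist x z < real n * \<l>" "dist z y < \<l>"
      using length_space_intermediate[OF len, of x y "real n * \<l>" \<l>] False l by auto
    then show ?thesis using Suc.IH[OF z(1)] step[OF z(2)] by (simp add: distrib_right)
  qed
qed simp

locale gradient_kernel_potential = gradient_kernel P C + bounded_function f M
  for P :: "'a::{second_countable_topology, metric_space} \<Rightarrow> 'a measure" and C and f :: "'a \<Rightarrow> real" and M +
  assumes f_meas: "f \<in> borel_measurable borel"
begin

definition P_hopf_lax :: "real \<Rightarrow> 'a \<Rightarrow> real" where
  "P_hopf_lax s x = (\<integral>y. hopf_lax f s y \<partial>P x)"

lemma P_hopf_lax_eq: "0 < s \<Longrightarrow> P_hopf_lax s = (\<lambda>x. \<integral>y. lip_fun (Lip_b (hopf_lax f s)) y \<partial>P x)"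
  by (simp add: P_hopf_lax_def lip_fun_Lip_b_hopf_lax fun_eq_iff)

lemma hopf_lax_integrable: "0 < s \<Longrightarrow> integrable (P x) (hopf_lax f s)"
  using P_integrable_lip[of x "Lip_b (hopf_lax f s)"] by (simp add: lip_fun_Lip_b_hopf_lax)

lemma P_hopf_lax_mono:
  assumes "0 < s" "s \<le> t" shows "P_hopf_lax t x \<le> P_hopf_lax s x"
  unfolding P_hopf_lax_def using assms
  by (intro integral_mono hopf_lax_integrable hopf_lax_antimono) auto

lemma lipschitz_P_hopf_lax:
  assumes "0 < s" shows "(sqrt C * (4 * sqrt (M / s)))-lipschitz_on UNIV (P_hopf_lax s)"
  unfolding P_hopf_lax_eq[OF assms] using assms M_nonneg
  by (intro lipschitz_P) (auto simp: lip_fun_Lip_b_hopf_lax slope_hopf_lax_le_sqrt)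

lemma slope_P_hopf_lax_le:
  assumes s: "0 < s" and t: "s < t"
  shows "slope (P_hopf_lax s) x \<le> ennreal (sqrt (4 * C * t / (s * (t - s)) * (P_hopf_lax s x - P_hopf_lax t x)))"
proof (rule ennreal_power2_le_imp_le)
  have nn: "0 \<le> 4 * C * t / (s * (t - s)) * (P_hopf_lax s x - P_hopf_lax t x)"
    using s t C_nonneg P_hopf_lax_mono[of s t x] by auto
  then show "0 \<le> sqrt (4 * C * t / (s * (t - s)) * (P_hopf_lax s x - P_hopf_lax t x))" by simp
  define G where "G y = 4 * t / (s * (t - s)) * (hopf_lax f s y - hopf_lax f t y)" for y
  have int: "integrable (P x) G"
    unfolding G_def using s t by (intro integrable_mult_right Bochner_Integration.integrable_diff
      hopf_lax_integrable) auto
  have "(slope (P_hopf_lax s) x)\<^sup>2 \<le> ennreal (C * (\<integral>y. G y \<partial>P x))"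
    unfolding P_hopf_lax_eq[OF s]
  proof (rule slope_P_power2_le[OF _ int])
    show "(slope (lip_fun (Lip_b (hopf_lax f s))) y)\<^sup>2 \<le> ennreal (G y)" for y
      unfolding lip_fun_Lip_b_hopf_lax[OF s] G_def by (rule slope_hopf_lax_le[OF s t])
    show "0 \<le> G y" for y
      using hopf_lax_antimono[of s t y] s t by (simp add: G_def)
  qed
  also have "C * (\<integral>y. G y \<partial>P x) = 4 * C * t / (s * (t - s)) * (P_hopf_lax s x - P_hopf_lax t x)"
    unfolding G_def P_hopf_lax_def using s t by (simp add: hopf_lax_integrable)
  also have "\<dots> = (sqrt (4 * C * t / (s * (t - s)) * (P_hopf_lax s x - P_hopf_lax t x)))\<^sup>2"
    using nn by simp
  finally show "(slope (P_hopf_lax s) x)\<^sup>2 \<le>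
    ennreal ((sqrt (4 * C * t / (s * (t - s)) * (P_hopf_lax s x - P_hopf_lax t x)))\<^sup>2)" .
qed

text \<open>The family \<open>P_hopf_lax\<close> is only monotone in time, so consecutive members need not be close in
  the Lipschitz norm. Averaging over a window of \<open>N\<close> time steps makes them close: consecutive
  averages differ by two boundary terms divided by \<open>N\<close>.\<close>

lemma averaged_P_hopf_lax_bound:
  assumes s: "0 < s" and h: "0 < h" and N: "0 < N" and n: "0 < n" and end_le: "s + real (n + N) * h \<le> 1"
    and xy: "dist x y < D"
  shows "P_hopf_lax 1 y - (\<integral>z. f z \<partial>P x) \<le>
    (1 + h / s) * C * D\<^sup>2 / (real n * h) + 2 * (sqrt C * (4 * sqrt (M / s))) / N * D"
proof -
  define S where "S k = s + real k * h" for k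
  define w where "w k z = (1 / N) * (\<Sum>i<N. P_hopf_lax (S (k + i)) z)" for k z
  define c where "c = 4 * C * (1 + h / s) / h"
  define L where "L = sqrt C * (4 * sqrt (M / s))"
  have S_pos: "0 < S k" and S_ge: "s \<le> S k" and S_Suc: "S (Suc k) = S k + h" and S_less: "S k < S (Suc k)" for k
    using s h by (auto simp: S_def distrib_right intro: add_pos_nonneg)
  have c: "0 \<le> c" using C_nonneg h s by (simp add: c_def)
  have L: "0 \<le> L" using C_nonneg M_nonneg s by (simp add: L_def)
  have D: "0 < D" using xy zero_le_dist[of x y] by linarith
  define g where "g k z = P_hopf_lax (S k) z - P_hopf_lax (S (Suc k)) z" for k z
  have g_nonneg: "0 \<le> g k z" for k z
    using P_hopf_lax_mono[OF S_pos less_imp_le[OF S_less]] by (simp add: g_def)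
  have w_diff: "w k z - w (Suc k) z = (1 / N) * (\<Sum>i<N. g (k + i) z)" for k z
    by (simp add: w_def g_def sum_subtractf right_diff_distrib)
  have slope_S: "slope (P_hopf_lax (S k)) z \<le> ennreal (sqrt (c * g k z))" for k z
  proof -
    have "4 * C * S (Suc k) / (S k * (S (Suc k) - S k)) = 4 * C * (1 + h / S k) / h"
      using S_pos[of k] h by (simp add: S_Suc field_simps)
    also have "\<dots> \<le> c"
      unfolding c_def using S_ge[of k] s h C_nonneg
      by (intro divide_right_mono mult_left_mono add_left_mono divide_left_mono) auto
    finally have "sqrt (4 * C * S (Suc k) / (S k * (S (Suc k) - S k)) * g k z) \<le> sqrt (c * g k z)"
      by (intro real_sqrt_le_mono mult_right_mono g_nonneg)
    then show ?thesis
      using slope_P_hopf_lax_le[OF S_pos S_less, of k z] unfolding g_def by (meson ennreal_leI order_trans)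
  qed
  have "w n y - w 0 x \<le> real n * (c * (D / n)\<^sup>2 / 4 + (2 * L / N) * (D / n))"
  proof (rule hamilton_jacobi_iterate[OF length c])
    show "slope (w k) z \<le> ennreal (sqrt (c * (w k z - w (Suc k) z)))" for k z
    proof -
      have "slope (w k) z \<le> ennreal ((1 / N) * (\<Sum>i<N. sqrt (c * g (k + i) z)))"
        unfolding w_def using N c g_nonneg
        by (intro slope_cmult_le slope_sum_le slope_S sum_nonneg) auto
      also have "(1 / N) * (\<Sum>i<N. sqrt (c * g (k + i) z)) \<le> sqrt (c * (w k z - w (Suc k) z))"
      proof (rule real_le_rsqrt)
        have "(\<Sum>i<N. sqrt (c * g (k + i) z))\<^sup>2 \<le> (\<Sum>i<N. (sqrt (c * g (k + i) z))\<^sup>2) * N"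
          using sum_squared_le_sum_of_squares[of "\<lambda>i. sqrt (c * g (k + i) z)" "{..<N}"] by simp
        also have "(\<Sum>i<N. (sqrt (c * g (k + i) z))\<^sup>2) = c * (\<Sum>i<N. g (k + i) z)"
          using c g_nonneg by (simp add: sum_distrib_left)
        finally have "(\<Sum>i<N. sqrt (c * g (k + i) z))\<^sup>2 \<le> c * (\<Sum>i<N. g (k + i) z) * N" .
        then have "(\<Sum>i<N. sqrt (c * g (k + i) z))\<^sup>2 / (real N)\<^sup>2 \<le> c * (\<Sum>i<N. g (k + i) z) * N / (real N)\<^sup>2"
          by (intro divide_right_mono) auto
        also have "\<dots> = c * (w k z - w (Suc k) z)"
          using N by (simp add: w_diff power2_eq_square)
        finally show "((1 / N) * (\<Sum>i<N. sqrt (c * g (k + i) z)))\<^sup>2 \<le> c * (w k z - w (Suc k) z)"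
          by (simp add: power_mult_distrib power_divide)
      qed
      finally show ?thesis by (simp add: ennreal_leI)
    qed
    show "w (Suc k) z \<le> w k z" for k z
    proof -
      have "0 \<le> (1 / N) * (\<Sum>i<N. g (k + i) z)" using g_nonneg by (simp add: sum_nonneg)
      then show ?thesis using w_diff[of k z] by linarith
    qed
    show "(2 * L / N)-lipschitz_on UNIV (\<lambda>z. w k z - w (Suc k) z)" for k
    proof -
      have "(\<Sum>i<N. g (k + i) z) = P_hopf_lax (S k) z - P_hopf_lax (S (k + N)) z" for z
        unfolding g_def by (induction N) auto
      then have eq: "(\<lambda>z. w k z - w (Suc k) z) = (\<lambda>z. (1 / N) * (P_hopf_lax (S k) z - P_hopf_lax (S (k + N)) z))"
        by (simp add: w_diff fun_eq_iff)
      have lipL: "L-lipschitz_on UNIV (P_hopf_lax (S j))" for j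
      proof (rule lipschitz_on_le[OF lipschitz_P_hopf_lax[OF S_pos]])
        show "sqrt C * (4 * sqrt (M / S j)) \<le> L"
          unfolding L_def using C_nonneg M_nonneg S_ge[of j] s
          by (intro mult_left_mono real_sqrt_le_mono divide_left_mono) auto
      qed
      have "(\<bar>1 / real N\<bar> * (L + L))-lipschitz_on UNIV (\<lambda>z. (1 / N) * (P_hopf_lax (S k) z - P_hopf_lax (S (k + N)) z))"
        by (intro lipschitz_on_cmult_real lipschitz_on_diff lipL)
      then show ?thesis unfolding eq by simp
    qed
    show "dist x y < real n * (D / n)" using xy n by simp
  qed (use L D n in auto)
  also have "real n * (c * (D / n)\<^sup>2 / 4 + (2 * L / N) * (D / n)) =
      (1 + h / s) * C * D\<^sup>2 / (real n * h) + 2 * L / N * D"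
    using n h s by (simp add: c_def power2_eq_square field_simps)
  finally have main: "w n y - w 0 x \<le> (1 + h / s) * C * D\<^sup>2 / (real n * h) + 2 * L / N * D" .
  have "P_hopf_lax 1 y \<le> w n y"
  proof -
    have "P_hopf_lax 1 y \<le> P_hopf_lax (S (n + i)) y" if "i < N" for i
    proof (rule P_hopf_lax_mono[OF S_pos])
      have "S (n + i) \<le> s + real (n + N) * h"
        unfolding S_def using that h by (intro add_left_mono mult_right_mono) auto
      then show "S (n + i) \<le> 1" using end_le by linarith
    qed
    then have "(\<Sum>i<N. P_hopf_lax 1 y) \<le> (\<Sum>i<N. P_hopf_lax (S (n + i)) y)" by (intro sum_mono) auto
    then show ?thesis using N by (simp add: w_def field_simps)
  qed
  moreover have "w 0 x \<le> (\<integral>z. f z \<partial>P x)"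
  proof -
    have "P_hopf_lax (S i) x \<le> (\<integral>z. f z \<partial>P x)" for i
      unfolding P_hopf_lax_def
      by (intro integral_mono hopf_lax_integrable S_pos hopf_lax_le_self P_integrable[OF f_meas bound])
    then have "(\<Sum>i<N. P_hopf_lax (S i) x) \<le> (\<Sum>i<N. (\<integral>z. f z \<partial>P x))" by (intro sum_mono) auto
    then show ?thesis using N by (simp add: w_def field_simps)
  qed
  ultimately show ?thesis using main unfolding L_def by linarith
qed

text \<open>Take \<open>s = 1/m\<close>, \<open>h = 1/m\<^sup>2\<close>, \<open>N = m\<close> and \<open>n = m\<^sup>2 - 2 m\<close> steps, which just fit into the time
  interval \<open>[0,1]\<close>. As \<open>m \<rightarrow> \<infinity>\<close>, the time \<open>2/m\<close> lost at the start and in the averaging window,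
  the ratio \<open>h/s = 1/m\<close> and the Lipschitz error of order \<open>\<surd>m / m\<close> all vanish.\<close>

lemma P_hopf_lax_contraction: "P_hopf_lax 1 y - (\<integral>z. f z \<partial>P x) \<le> C * (dist x y)\<^sup>2"
proof -
  define B where "B m = (1 + 1 / real m) * C * (dist x y + 1 / real m)\<^sup>2 / (1 - 2 / real m)
    + 8 * sqrt C * sqrt M * (dist x y + 1 / real m) * sqrt (1 / real m)" for m :: nat
  have le: "P_hopf_lax 1 y - (\<integral>z. f z \<partial>P x) \<le> B m" if m: "3 \<le> m" for m :: nat
  proof -
    have m': "0 < real m" "m * 2 < m * m" using m by auto
    have "real (m * m - 2 * m) = real m * real m - 2 * real m"
      using m' by (simp add: of_nat_diff)
    note n = this
    have "P_hopf_lax 1 y - (\<integral>z. f z \<partial>P x) \<le>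
      (1 + (1 / (real m)\<^sup>2) / (1 / real m)) * C * (dist x y + 1 / real m)\<^sup>2 / (real (m * m - 2 * m) * (1 / (real m)\<^sup>2))
      + 2 * (sqrt C * (4 * sqrt (M / (1 / real m)))) / m * (dist x y + 1 / real m)"
    proof (rule averaged_P_hopf_lax_bound)
      show "1 / real m + real (m * m - 2 * m + m) * (1 / (real m)\<^sup>2) \<le> 1"
        unfolding of_nat_add n using m' by (simp add: field_simps power2_eq_square)
    qed (use m m' in auto)
    also have "(1 / (real m)\<^sup>2) / (1 / real m) = 1 / real m"
      using m' by (simp add: power2_eq_square)
    also have "real (m * m - 2 * m) * (1 / (real m)\<^sup>2) = 1 - 2 / real m"
      unfolding n using m' by (simp add: field_simps power2_eq_square)
    also have "2 * (sqrt C * (4 * sqrt (M / (1 / real m)))) / m = 8 * sqrt C * sqrt M * sqrt (1 / real m)"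
      using m' by (simp add: real_sqrt_mult real_sqrt_divide real_div_sqrt field_simps)
    finally show ?thesis by (simp add: B_def mult.commute mult.left_commute)
  qed
  have "B \<longlonglongrightarrow> (1 + 0) * C * (dist x y + 0)\<^sup>2 / (1 - 0) + 8 * sqrt C * sqrt M * (dist x y + 0) * sqrt 0"
    unfolding B_def by (intro tendsto_intros) simp
  moreover have "\<forall>\<^sub>F m in sequentially. P_hopf_lax 1 y - (\<integral>z. f z \<partial>P x) \<le> B m"
    by (rule eventually_sequentiallyI[of 3]) (rule le)
  ultimately have "P_hopf_lax 1 y - (\<integral>z. f z \<partial>P x) \<le>
      (1 + 0) * C * (dist x y + 0)\<^sup>2 / (1 - 0) + 8 * sqrt C * sqrt M * (dist x y + 0) * sqrt 0"
    by (intro tendsto_lowerbound[where F = sequentially and f = B]) simp_all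
  then show ?thesis by simp
qed

end

text \<open>Admissibility of \<open>(f, g)\<close> means \<open>g \<le> Q\<^sub>1 f\<close>, so the kernel maps admissible potentials for the
  cost \<open>d\<^sup>2\<close> to admissible potentials for the cost \<open>C d\<^sup>2\<close>.\<close>

lemma (in gradient_kernel) dual_potential_contraction:
  fixes f g :: "'a \<Rightarrow> real"
  assumes f: "f \<in> borel_measurable borel" "\<And>z. \<bar>f z\<bar> \<le> M"
    and g: "g \<in> borel_measurable borel" "\<And>z. \<bar>g z\<bar> \<le> M"
    and fg: "\<And>x y. g y - f x \<le> (dist x y)\<^sup>2"
  shows "(\<integral>z. g z \<partial>P y) - (\<integral>z. f z \<partial>P x) \<le> C * (dist x y)\<^sup>2"
proof -
  interpret gradient_kernel_potential P C f M
    by unfold_locales (use f in auto)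
  have "(\<integral>z. g z \<partial>P y) \<le> P_hopf_lax 1 y"
    unfolding P_hopf_lax_def
  proof (intro integral_mono P_integrable[OF g] hopf_lax_integrable)
    show "g z \<le> hopf_lax f 1 z" for z
      using fg[of z] by (intro hopf_lax_ge) (simp add: algebra_simps dist_commute)
  qed simp
  then show ?thesis using P_hopf_lax_contraction[of y x] by linarith
qed

section \<open>Discrete optimal transport\<close>

lemma compact_box:
  fixes a b :: real
  shows "compact {p :: 'i \<Rightarrow> real. \<forall>k. p k \<in> {a..b}}"
proof -
  have "compactin (product_topology (\<lambda>_::'i. euclidean) UNIV) (PiE UNIV (\<lambda>_. {a..b}))"
    unfolding compactin_PiE by (auto simp: compactin_euclidean_iff)
  moreover have "PiE UNIV (\<lambda>_. {a..b}) = {p :: 'i \<Rightarrow> real. \<forall>k. p k \<in> {a..b}}"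
    by (auto simp: PiE_def)
  ultimately show ?thesis
    by (simp add: euclidean_product_topology compactin_euclidean_iff)
qed

text \<open>The marginal constraints are replaced by a quadratic penalty, so that the minimizer only
  has the sign constraints \<open>p \<ge> 0\<close>. Its first-order conditions say that the rescaled marginal
  errors are admissible dual potentials, tight wherever \<open>p > 0\<close>; testing the dual bound with
  them gives both claims at once. The upper bound \<open>3\<close> on the box makes it compact and is not
  attained at indices below \<open>N\<close>, because comparison with \<open>p = 0\<close> keeps the marginal errors below \<open>2\<close>.\<close>

lemma penalized_transport:
  fixes c :: "nat \<Rightarrow> nat \<Rightarrow> real" and m n :: "nat \<Rightarrow> real"
  assumes \<epsilon>: "0 < \<epsilon>" and c: "\<And>i j. 0 \<le> c i j"
    and m: "\<And>i. 0 \<le> m i" "(\<Sum>i<N. m i) \<le> 1" and n: "\<And>j. 0 \<le> n j" "(\<Sum>j<N. n j) \<le> 1"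
    and dual: "\<And>f g. (\<And>i j. i < N \<Longrightarrow> j < N \<Longrightarrow> g j - f i \<le> c i j) \<Longrightarrow>
       (\<Sum>j<N. g j * n j) - (\<Sum>i<N. f i * m i) \<le> K"
  obtains p :: "nat \<times> nat \<Rightarrow> real" where "\<And>k. p k \<in> {0..3}"
    "(\<Sum>i<N. \<Sum>j<N. c i j * p (i, j)) \<le> K"
    "(\<Sum>i<N. ((\<Sum>j<N. p (i, j)) - m i)\<^sup>2) \<le> \<epsilon> * K"
    "(\<Sum>j<N. ((\<Sum>i<N. p (i, j)) - n j)\<^sup>2) \<le> \<epsilon> * K"
proof -
  define row where "row p i = (\<Sum>j<N. p (i, j))" for p :: "nat \<times> nat \<Rightarrow> real" and i
  define col where "col p j = (\<Sum>i<N. p (i, j))" for p :: "nat \<times> nat \<Rightarrow> real" and j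
  define pen where "pen p = (\<Sum>i<N. (row p i - m i)\<^sup>2) + (\<Sum>j<N. (col p j - n j)\<^sup>2)" for p
  define F where "F p = (\<Sum>i<N. \<Sum>j<N. c i j * p (i, j)) + pen p / (2 * \<epsilon>)" for p
  define B where "B = {p :: nat \<times> nat \<Rightarrow> real. \<forall>k. p k \<in> {0..3}}"
  have "continuous_on B F"
    unfolding F_def pen_def row_def col_def
    using \<epsilon> by (intro continuous_intros continuous_on_product_then_coordinatewise[OF continuous_on_id]) auto
  moreover have "compact B" unfolding B_def by (rule compact_box)
  moreover have zero: "(\<lambda>_. 0) \<in> B" by (simp add: B_def)
  ultimately obtain p where p: "p \<in> B" and p_min: "\<And>q. q \<in> B \<Longrightarrow> F p \<le> F q"
    using continuous_attains_inf[of B F] by blast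
  have p_nonneg: "0 \<le> p k" for k using p by (cases k) (simp add: B_def)
  have cost_nonneg: "0 \<le> (\<Sum>i<N. \<Sum>j<N. c i j * p (i, j))"
    by (intro sum_nonneg mult_nonneg_nonneg c p_nonneg)
  have sum_sq: "(\<Sum>i<N. (u i)\<^sup>2) \<le> 1" if "\<And>i. 0 \<le> u i" "(\<Sum>i<N. u i) \<le> 1" for u :: "nat \<Rightarrow> real"
  proof -
    have "u i \<le> 1" if "i < N" for i
      using member_le_sum[of i "{..<N}" u] that \<open>\<And>i. 0 \<le> u i\<close> \<open>(\<Sum>i<N. u i) \<le> 1\<close> by auto
    then have "(\<Sum>i<N. (u i)\<^sup>2) \<le> (\<Sum>i<N. u i)"
      using that(1) by (intro sum_mono) (auto simp: power2_eq_square intro: mult_left_le)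
    then show ?thesis using that(2) by linarith
  qed
  have pen_le: "pen p \<le> 2"
  proof -
    have "F p \<le> F (\<lambda>_. 0)" by (rule p_min[OF zero])
    also have "\<dots> = ((\<Sum>i<N. (m i)\<^sup>2) + (\<Sum>j<N. (n j)\<^sup>2)) / (2 * \<epsilon>)"
      by (simp add: F_def pen_def row_def col_def)
    also have "\<dots> \<le> 2 / (2 * \<epsilon>)"
      using sum_sq[OF m] sum_sq[OF n] \<epsilon> by (intro divide_right_mono) auto
    finally have "pen p / (2 * \<epsilon>) \<le> 2 / (2 * \<epsilon>)" using cost_nonneg by (simp add: F_def)
    then show ?thesis using \<epsilon> by (simp add: field_simps)
  qed
  have p_less: "p (i, j) < 3" if "i < N" "j < N" for i j
  proof -
    have "(row p i - m i)\<^sup>2 \<le> (\<Sum>i<N. (row p i - m i)\<^sup>2)"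
      using that by (intro member_le_sum) auto
    also have "\<dots> \<le> pen p" unfolding pen_def by (simp add: sum_nonneg)
    also have "\<dots> < 2\<^sup>2" using pen_le by simp
    finally have "row p i - m i < 2" by (rule power2_less_imp_less) simp
    moreover have "m i \<le> (\<Sum>i<N. m i)" using that m(1) by (intro member_le_sum) auto
    moreover have "p (i, j) \<le> row p i"
      unfolding row_def using that p_nonneg by (intro member_le_sum[of j "{..<N}" "\<lambda>j. p (i, j)"]) auto
    ultimately show ?thesis using m(2) by linarith
  qed
  define f where "f i = (row p i - m i) / \<epsilon>" for i
  define g where "g j = - (col p j - n j) / \<epsilon>" for j
  define slack where "slack i j = c i j - (g j - f i)" for i j
  have var: "0 \<le> t * slack i j + t\<^sup>2 / \<epsilon>"
    if ij: "i < N" "j < N" and t: "- p (i, j) \<le> t" "t \<le> 3 - p (i, j)" for i j t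
  proof -
    define q where "q = (\<lambda>k. p k + (if k = (i, j) then t else 0))"
    have "q \<in> B" using p t by (auto simp: q_def B_def)
    then have "F p \<le> F q" by (rule p_min)
    have row_q: "row q i' = row p i' + (if i' = i then t else 0)" for i'
      using ij by (cases "i' = i") (auto simp: row_def q_def sum.distrib)
    have col_q: "col q j' = col p j' + (if j' = j then t else 0)" for j'
      using ij by (cases "j' = j") (auto simp: col_def q_def sum.distrib)
    have "(row q i' - m i')\<^sup>2 = (row p i' - m i')\<^sup>2 + (if i' = i then 2 * t * (row p i - m i) + t\<^sup>2 else 0)" for i'
      unfolding row_q by (auto simp: power2_eq_square algebra_simps)
    then have "(\<Sum>i'<N. (row q i' - m i')\<^sup>2) = (\<Sum>i'<N. (row p i' - m i')\<^sup>2) + (2 * t * (row p i - m i) + t\<^sup>2)"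
      using ij by (simp add: sum.distrib)
    moreover have "(col q j' - n j')\<^sup>2 = (col p j' - n j')\<^sup>2 + (if j' = j then 2 * t * (col p j - n j) + t\<^sup>2 else 0)" for j'
      unfolding col_q by (auto simp: power2_eq_square algebra_simps)
    then have "(\<Sum>j'<N. (col q j' - n j')\<^sup>2) = (\<Sum>j'<N. (col p j' - n j')\<^sup>2) + (2 * t * (col p j - n j) + t\<^sup>2)"
      using ij by (simp add: sum.distrib)
    ultimately have pen_q: "pen q = pen p + 2 * t * ((row p i - m i) + (col p j - n j)) + 2 * t\<^sup>2"
      by (simp add: pen_def algebra_simps)
    have "(\<Sum>j'<N. c i' j' * q (i', j')) = (\<Sum>j'<N. c i' j' * p (i', j')) + (if i' = i then c i j * t else 0)" for i'
      using ij by (cases "i' = i") (auto simp: q_def distrib_left sum.distrib if_distrib[of "\<lambda>x. _ * x"] cong: if_cong)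
    then have "(\<Sum>i'<N. \<Sum>j'<N. c i' j' * q (i', j')) = (\<Sum>i'<N. \<Sum>j'<N. c i' j' * p (i', j')) + c i j * t"
      using ij by (simp add: sum.distrib)
    then have "F q - F p = c i j * t + (2 * t * ((row p i - m i) + (col p j - n j)) + 2 * t\<^sup>2) / (2 * \<epsilon>)"
      by (simp add: F_def pen_q add_divide_distrib)
    also have "\<dots> = t * slack i j + t\<^sup>2 / \<epsilon>"
      using \<epsilon> by (simp add: slack_def f_def g_def field_simps)
    finally show ?thesis using \<open>F p \<le> F q\<close> by simp
  qed
  have slack_nonneg: "0 \<le> slack i j" if ij: "i < N" "j < N" for i j
  proof (rule ccontr)
    assume neg: "\<not> 0 \<le> slack i j"
    define t where "t = min (3 - p (i, j)) (- slack i j * \<epsilon> / 2)"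
    have t: "0 < t" using p_less[OF ij] neg \<epsilon> by (auto simp: t_def mult_neg_pos)
    have "t \<le> - slack i j * \<epsilon> / 2" by (simp add: t_def)
    moreover have "slack i j * \<epsilon> < 0" using neg \<epsilon> by (simp add: mult_neg_pos)
    ultimately have "slack i j * \<epsilon> + t < 0" by linarith
    then have "slack i j + t / \<epsilon> < 0" using \<epsilon> by (simp add: field_simps)
    then have "t * (slack i j + t / \<epsilon>) < 0" using t by (rule mult_pos_neg[rotated])
    moreover have "0 \<le> t * slack i j + t\<^sup>2 / \<epsilon>"
    proof (rule var[OF ij])
      show "- p (i, j) \<le> t" using t p_nonneg[of "(i, j)"] by linarith
      show "t \<le> 3 - p (i, j)" by (simp add: t_def)
    qed
    ultimately show False by (simp add: power2_eq_square distrib_left)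
  qed
  have slack_tight: "p (i, j) * slack i j = 0" if ij: "i < N" "j < N" for i j
  proof (rule ccontr)
    assume "p (i, j) * slack i j \<noteq> 0"
    then have pos: "0 < p (i, j)" "0 < slack i j"
      using p_nonneg[of "(i, j)"] slack_nonneg[OF ij] by auto
    define t where "t = min (p (i, j)) (slack i j * \<epsilon> / 2)"
    have t: "0 < t" using pos \<epsilon> by (simp add: t_def)
    have "t \<le> slack i j * \<epsilon> / 2" by (simp add: t_def)
    moreover have "0 < slack i j * \<epsilon>" using pos \<epsilon> by simp
    ultimately have "0 < slack i j * \<epsilon> - t" by linarith
    then have "0 < slack i j - t / \<epsilon>" using \<epsilon> by (simp add: field_simps)
    then have "0 < t * (slack i j - t / \<epsilon>)" using t by simp
    moreover have "0 \<le> (- t) * slack i j + (- t)\<^sup>2 / \<epsilon>"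
    proof (rule var[OF ij])
      show "- p (i, j) \<le> - t" by (simp add: t_def)
      show "- t \<le> 3 - p (i, j)" using t p_less[OF ij] by linarith
    qed
    ultimately show False by (simp add: power2_eq_square right_diff_distrib)
  qed
  have "(\<Sum>i<N. \<Sum>j<N. c i j * p (i, j)) = (\<Sum>i<N. \<Sum>j<N. (g j - f i) * p (i, j))"
    using slack_tight by (intro sum.cong refl) (auto simp: slack_def algebra_simps)
  also have "\<dots> = (\<Sum>i<N. \<Sum>j<N. g j * p (i, j)) - (\<Sum>i<N. \<Sum>j<N. f i * p (i, j))"
    by (simp add: left_diff_distrib sum_subtractf)
  also have "(\<Sum>i<N. \<Sum>j<N. g j * p (i, j)) = (\<Sum>j<N. g j * col p j)"
    unfolding col_def sum_distrib_left by (rule sum.swap)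
  also have "(\<Sum>i<N. \<Sum>j<N. f i * p (i, j)) = (\<Sum>i<N. f i * row p i)"
    unfolding row_def sum_distrib_left ..
  finally have cost: "(\<Sum>i<N. \<Sum>j<N. c i j * p (i, j)) = (\<Sum>j<N. g j * col p j) - (\<Sum>i<N. f i * row p i)" .
  have "(\<Sum>j<N. g j * n j) - (\<Sum>i<N. f i * m i) \<le> K"
    using slack_nonneg by (intro dual) (simp add: slack_def)
  moreover have "(\<Sum>j<N. g j * n j) = (\<Sum>j<N. g j * col p j) + (\<Sum>j<N. (col p j - n j)\<^sup>2) / \<epsilon>"
    unfolding sum_divide_distrib sum.distrib[symmetric]
    using \<epsilon> by (intro sum.cong refl) (simp add: g_def field_simps power2_eq_square)
  moreover have "(\<Sum>i<N. f i * m i) = (\<Sum>i<N. f i * row p i) - (\<Sum>i<N. (row p i - m i)\<^sup>2) / \<epsilon>"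
    unfolding sum_divide_distrib sum_subtractf[symmetric]
    using \<epsilon> by (intro sum.cong refl) (simp add: f_def field_simps power2_eq_square)
  ultimately have total: "(\<Sum>i<N. \<Sum>j<N. c i j * p (i, j)) + pen p / \<epsilon> \<le> K"
    unfolding cost pen_def by (simp add: add_divide_distrib)
  have pen_parts: "0 \<le> (\<Sum>i<N. (row p i - m i)\<^sup>2)" "0 \<le> (\<Sum>j<N. (col p j - n j)\<^sup>2)"
    by (auto intro: sum_nonneg)
  then have "0 \<le> pen p / \<epsilon>" using \<epsilon> by (simp add: pen_def)
  then have "(\<Sum>i<N. \<Sum>j<N. c i j * p (i, j)) \<le> K" using total by linarith
  moreover have "pen p / \<epsilon> \<le> K" using total cost_nonneg by linarith
  then have "pen p \<le> \<epsilon> * K" using \<epsilon> by (simp add: field_simps)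
  moreover have "p k \<in> {0..3}" for k using p unfolding B_def by blast
  ultimately show thesis
    using that[of p] pen_parts unfolding pen_def row_def col_def by simp
qed

text \<open>Mass cannot escape to infinity in the column index, because the tails of all approximate
  column marginals are controlled by the tail of the convergent series \<open>n\<close>.\<close>

lemma row_sums_limit:
  fixes q :: "nat \<Rightarrow> nat \<Rightarrow> nat \<Rightarrow> real"
  assumes lim: "\<And>j. (\<lambda>k. q k i j) \<longlonglongrightarrow> p j" and nonneg: "\<And>k i j. 0 \<le> q k i j"
    and N: "filterlim N at_top sequentially" and \<eta>: "\<eta> \<longlonglongrightarrow> 0"
    and row: "\<And>k. i < N k \<Longrightarrow> \<bar>(\<Sum>j<Suc (N k). q k i j) - m\<bar> \<le> \<eta> k"
    and tail: "\<And>k J. J \<le> N k \<Longrightarrow>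
      (\<Sum>j\<in>{J..<Suc (N k)}. \<Sum>i<Suc (N k). q k i j) \<le> 1 - (\<Sum>j<J. n j) + \<eta> k"
    and n: "n sums 1"
  shows "p sums m"
proof -
  have large: "\<forall>\<^sub>F k in sequentially. i < N k \<and> J \<le> N k" for J
  proof -
    have "\<forall>\<^sub>F k in sequentially. max J (Suc i) \<le> N k" using N unfolding filterlim_at_top by blast
    then show ?thesis by (rule eventually_mono) simp
  qed
  have split: "(\<Sum>j<Suc (N k). q k i j) = (\<Sum>j<J. q k i j) + (\<Sum>j\<in>{J..<Suc (N k)}. q k i j)"
    if "J \<le> N k" for J k
    using that by (simp add: lessThan_atLeast0 sum.atLeastLessThan_concat)
  have lim_sum: "(\<lambda>k. \<Sum>j<J. q k i j) \<longlonglongrightarrow> (\<Sum>j<J. p j)" for J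
    by (intro tendsto_sum lim)
  have upper: "(\<Sum>j<J. p j) \<le> m" for J
  proof (rule tendsto_le[OF _ _ lim_sum])
    show "(\<lambda>k. m + \<eta> k) \<longlonglongrightarrow> m" using tendsto_add[OF tendsto_const \<eta>, of m] by simp
    show "\<forall>\<^sub>F k in sequentially. (\<Sum>j<J. q k i j) \<le> m + \<eta> k"
      using large[of J]
    proof eventually_elim
      case (elim k)
      have "0 \<le> (\<Sum>j\<in>{J..<Suc (N k)}. q k i j)" by (intro sum_nonneg nonneg)
      then show ?case using elim split[of J k] row[of k] by (auto simp: abs_le_iff)
    qed
  qed simp
  have lower: "m - (1 - (\<Sum>j<J. n j)) \<le> (\<Sum>j<J. p j)" for J
  proof (rule tendsto_le[OF _ lim_sum])
    show "(\<lambda>k. m - (1 - (\<Sum>j<J. n j)) - 2 * \<eta> k) \<longlonglongrightarrow> m - (1 - (\<Sum>j<J. n j))"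
      using tendsto_diff[OF tendsto_const tendsto_mult[OF tendsto_const \<eta>], of "m - (1 - (\<Sum>j<J. n j))" 2]
      by simp
    show "\<forall>\<^sub>F k in sequentially. m - (1 - (\<Sum>j<J. n j)) - 2 * \<eta> k \<le> (\<Sum>j<J. q k i j)"
      using large[of J]
    proof eventually_elim
      case (elim k)
      have "(\<Sum>j\<in>{J..<Suc (N k)}. q k i j) \<le> (\<Sum>j\<in>{J..<Suc (N k)}. \<Sum>i<Suc (N k). q k i j)"
        using elim nonneg by (intro sum_mono member_le_sum[of i]) auto
      also have "\<dots> \<le> 1 - (\<Sum>j<J. n j) + \<eta> k" using elim by (intro tail) auto
      finally show ?case using elim split[of J k] row[of k] by (auto simp: abs_le_iff)
    qed
  qed simp
  have "(\<lambda>J. m - (1 - (\<Sum>j<J. n j))) \<longlonglongrightarrow> m - (1 - 1)"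
    using n unfolding sums_def by (intro tendsto_intros)
  then have "(\<lambda>J. m - (1 - (\<Sum>j<J. n j))) \<longlonglongrightarrow> m" by simp
  from tendsto_sandwich[OF _ _ this tendsto_const]
  have "(\<lambda>J. \<Sum>j<J. p j) \<longlonglongrightarrow> m" by (simp add: lower upper)
  then show ?thesis by (simp add: sums_def)
qed

text \<open>For \<open>m\<close> of total mass \<open>1\<close>: the mass of all indices from \<open>N\<close> on is collected in the index
  \<open>N\<close>.\<close>

definition lump :: "nat \<Rightarrow> (nat \<Rightarrow> real) \<Rightarrow> nat \<Rightarrow> real" where
  "lump N m i = (if i < N then m i else if i = N then 1 - (\<Sum>i<N. m i) else 0)"

lemma sum_lump: "J \<le> N \<Longrightarrow> (\<Sum>i\<in>{J..<Suc N}. lump N m i) = 1 - (\<Sum>i<J. m i)"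
proof -
  assume J: "J \<le> N"
  have "(\<Sum>i\<in>{J..<Suc N}. lump N m i) = (\<Sum>i\<in>{J..<N}. m i) + (1 - (\<Sum>i<N. m i))"
    using J by (simp add: lump_def)
  moreover have "(\<Sum>i<N. m i) = (\<Sum>i<J. m i) + (\<Sum>i\<in>{J..<N}. m i)"
    using J by (simp add: lessThan_atLeast0 sum.atLeastLessThan_concat)
  ultimately show ?thesis by simp
qed

lemma lump_nonneg:
  assumes "\<And>i. 0 \<le> m i" "m sums 1" shows "0 \<le> lump N m i"
proof -
  have "(\<Sum>i<N. m i) \<le> 1"
    using assms by (metis sum_le_suminf finite_lessThan sums_summable sums_unique)
  then show ?thesis using assms by (simp add: lump_def)
qed

lemma sum_abs_le_sqrt:
  fixes u :: "'i \<Rightarrow> real"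
  assumes "finite I" "(\<Sum>i\<in>I. (u i)\<^sup>2) \<le> A" "J \<subseteq> I"
  shows "\<bar>\<Sum>i\<in>J. u i\<bar> \<le> sqrt (A * card I)"
proof (rule real_le_rsqrt)
  have "(\<Sum>i\<in>J. u i)\<^sup>2 \<le> (\<Sum>i\<in>J. (u i)\<^sup>2) * card J" by (rule sum_squared_le_sum_of_squares)
  also have "\<dots> \<le> A * card I"
  proof (rule mult_mono)
    show "(\<Sum>i\<in>J. (u i)\<^sup>2) \<le> A"
      using assms sum_mono2[OF assms(1,3), of "\<lambda>i. (u i)\<^sup>2"] by simp
    show "0 \<le> A" using assms(2) sum_nonneg[of I "\<lambda>i. (u i)\<^sup>2"] by simp
  qed (use assms card_mono in auto)
  finally show "\<bar>\<Sum>i\<in>J. u i\<bar>\<^sup>2 \<le> A * card I" by simp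
qed

text \<open>The tail is lumped into one extra index with zero cost, where the finite problem is solved
  approximately; a coordinatewise limit of these solutions is an exact coupling, and its cost
  is lower semicontinuous.\<close>

lemma countable_transport:
  fixes c :: "nat \<Rightarrow> nat \<Rightarrow> real" and m n :: "nat \<Rightarrow> real"
  assumes c: "\<And>i j. 0 \<le> c i j"
    and m: "\<And>i. 0 \<le> m i" "m sums 1" and n: "\<And>j. 0 \<le> n j" "n sums 1"
    and dual: "\<And>N f g. (\<And>i j. i \<le> N \<Longrightarrow> j \<le> N \<Longrightarrow> g j - f i \<le> (if i < N \<and> j < N then c i j else 0)) \<Longrightarrow>
       (\<Sum>j<Suc N. g j * lump N n j) - (\<Sum>i<Suc N. f i * lump N m i) \<le> K"
  obtains p :: "nat \<Rightarrow> nat \<Rightarrow> real" where "\<And>i j. 0 \<le> p i j"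
    "\<And>i. (\<lambda>j. p i j) sums m i" "\<And>j. (\<lambda>i. p i j) sums n j"
    "\<And>J. (\<Sum>i<J. \<Sum>j<J. c i j * p i j) \<le> K"
proof -
  have K: "0 \<le> K" using dual[of 0 "\<lambda>_. 0" "\<lambda>_. 0"] by simp
  define Q where "Q N p \<longleftrightarrow> (\<forall>k. p k \<in> {0..3}) \<and>
    (\<Sum>i<Suc N. \<Sum>j<Suc N. (if i < N \<and> j < N then c i j else 0) * p (i, j)) \<le> K \<and>
    (\<Sum>i<Suc N. ((\<Sum>j<Suc N. p (i, j)) - lump N m i)\<^sup>2) \<le> 1 / (real (Suc N))\<^sup>2 * K \<and>
    (\<Sum>j<Suc N. ((\<Sum>i<Suc N. p (i, j)) - lump N n j)\<^sup>2) \<le> 1 / (real (Suc N))\<^sup>2 * K"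
    for N and p :: "nat \<times> nat \<Rightarrow> real"
  have "\<exists>p. Q N p" for N
  proof (rule penalized_transport[of "1 / (real (Suc N))\<^sup>2" "\<lambda>i j. if i < N \<and> j < N then c i j else 0"
        "lump N m" "Suc N" "lump N n" K])
    show "(\<Sum>i<Suc N. lump N m i) \<le> 1" "(\<Sum>i<Suc N. lump N n i) \<le> 1"
      using sum_lump[of 0 N] by (simp_all add: lessThan_atLeast0 del: sum.op_ivl_Suc)
    show "(\<Sum>j<Suc N. g j * lump N n j) - (\<Sum>i<Suc N. f i * lump N m i) \<le> K"
      if "\<And>i j. i < Suc N \<Longrightarrow> j < Suc N \<Longrightarrow> g j - f i \<le> (if i < N \<and> j < N then c i j else 0)" for f g
      using that by (intro dual) auto
  next
    show "\<exists>p. Q N p" if "\<And>k. p k \<in> {0..3}"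
      "(\<Sum>i<Suc N. \<Sum>j<Suc N. (if i < N \<and> j < N then c i j else 0) * p (i, j)) \<le> K"
      "(\<Sum>i<Suc N. ((\<Sum>j<Suc N. p (i, j)) - lump N m i)\<^sup>2) \<le> 1 / (real (Suc N))\<^sup>2 * K"
      "(\<Sum>j<Suc N. ((\<Sum>i<Suc N. p (i, j)) - lump N n j)\<^sup>2) \<le> 1 / (real (Suc N))\<^sup>2 * K" for p
      unfolding Q_def using that by blast
  qed (simp_all add: c lump_nonneg[OF m] lump_nonneg[OF n])
  then obtain P where P: "\<And>N. Q N (P N)" by metis
  note P_cost = P[unfolded Q_def, THEN conjunct2, THEN conjunct1]
    and P_row = P[unfolded Q_def, THEN conjunct2, THEN conjunct2, THEN conjunct1]
    and P_col = P[unfolded Q_def, THEN conjunct2, THEN conjunct2, THEN conjunct2]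
  have P_box: "P N k \<in> {0..3}" for N k using P[of N] unfolding Q_def by blast
  have P_nonneg: "0 \<le> P N k" for N k using P_box[of N k] by simp
  have "seq_compact {p :: nat \<times> nat \<Rightarrow> real. \<forall>k. p k \<in> {0..3}}"
    by (intro compact_imp_seq_compact compact_box)
  moreover have "\<forall>N. P N \<in> {p. \<forall>k. p k \<in> {0..3}}" using P_box by blast
  ultimately obtain p0 \<phi> where \<phi>: "strict_mono \<phi>" and p0: "(P \<circ> \<phi>) \<longlonglongrightarrow> p0"
    unfolding seq_compact_def by metis
  define p where "p i j = p0 (i, j)" for i j
  have lim: "(\<lambda>k. P (\<phi> k) (i, j)) \<longlonglongrightarrow> p i j" for i j
    using continuous_on_tendsto_compose[OF continuous_on_product_coordinates p0, of "(i, j)"]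
    by (simp add: p_def)
  define \<eta> where "\<eta> N = sqrt (1 / (real (Suc N))\<^sup>2 * K * card {..<Suc N})" for N
  have "\<eta> \<longlonglongrightarrow> sqrt (0 * K)"
  proof -
    have "\<eta> N = sqrt (inverse (real (Suc N)) * K)" for N
    proof -
      have "1 / x\<^sup>2 * K * x = inverse x * K" if "x \<noteq> 0" for x :: real
        using that by (simp add: power2_eq_square inverse_eq_divide)
      then show ?thesis by (simp add: \<eta>_def del: of_nat_Suc)
    qed
    moreover have "(\<lambda>N. sqrt (inverse (real (Suc N)) * K)) \<longlonglongrightarrow> sqrt (0 * K)"
      by (intro tendsto_intros LIMSEQ_inverse_real_of_nat)
    ultimately show ?thesis by presburger
  qed
  then have "\<eta> \<longlonglongrightarrow> 0" by simp
  from LIMSEQ_subseq_LIMSEQ[OF this \<phi>]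
  have \<eta>: "(\<lambda>k. \<eta> (\<phi> k)) \<longlonglongrightarrow> 0" by (simp add: comp_def)
  have row_err: "\<bar>\<Sum>i\<in>I. (\<Sum>j<Suc N. P N (i, j)) - lump N m i\<bar> \<le> \<eta> N" if "I \<subseteq> {..<Suc N}" for I N
    unfolding \<eta>_def by (rule sum_abs_le_sqrt[OF _ P_row that]) simp
  have col_err: "\<bar>\<Sum>j\<in>I. (\<Sum>i<Suc N. P N (i, j)) - lump N n j\<bar> \<le> \<eta> N" if "I \<subseteq> {..<Suc N}" for I N
    unfolding \<eta>_def by (rule sum_abs_le_sqrt[OF _ P_col that]) simp
  have \<phi>_top: "filterlim \<phi> at_top sequentially" by (rule filterlim_subseq[OF \<phi>])
  have "0 \<le> p i j" for i j
    by (rule tendsto_lowerbound[OF lim]) (simp_all add: P_nonneg)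
  moreover have "(\<lambda>j. p i j) sums m i" for i
  proof (rule row_sums_limit[where q = "\<lambda>k i j. P (\<phi> k) (i, j)" and i = i and N = \<phi>
        and \<eta> = "\<lambda>k. \<eta> (\<phi> k)" and n = n])
    show "\<bar>(\<Sum>j<Suc (\<phi> k). P (\<phi> k) (i, j)) - m i\<bar> \<le> \<eta> (\<phi> k)" if "i < \<phi> k" for k
      using row_err[of "{i}" "\<phi> k"] that by (simp add: lump_def)
    show "(\<Sum>j = J..<Suc (\<phi> k). \<Sum>i<Suc (\<phi> k). P (\<phi> k) (i, j)) \<le> 1 - (\<Sum>j<J. n j) + \<eta> (\<phi> k)"
      if "J \<le> \<phi> k" for J k
    proof -
      have "{J..<Suc (\<phi> k)} \<subseteq> {..<Suc (\<phi> k)}" by auto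
      from abs_le_D1[OF col_err[OF this]] show ?thesis
        using sum_lump[OF that, of n] unfolding sum_subtractf by linarith
    qed
  qed (use lim P_nonneg \<phi>_top \<eta> n in auto)
  moreover have "(\<lambda>i. p i j) sums n j" for j
  proof (rule row_sums_limit[where q = "\<lambda>k j i. P (\<phi> k) (i, j)" and i = j and N = \<phi>
        and \<eta> = "\<lambda>k. \<eta> (\<phi> k)" and n = m])
    show "\<bar>(\<Sum>i<Suc (\<phi> k). P (\<phi> k) (i, j)) - n j\<bar> \<le> \<eta> (\<phi> k)" if "j < \<phi> k" for k
      using col_err[of "{j}" "\<phi> k"] that by (simp add: lump_def)
    show "(\<Sum>i = J..<Suc (\<phi> k). \<Sum>j<Suc (\<phi> k). P (\<phi> k) (i, j)) \<le> 1 - (\<Sum>i<J. m i) + \<eta> (\<phi> k)"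
      if "J \<le> \<phi> k" for J k
    proof -
      have "{J..<Suc (\<phi> k)} \<subseteq> {..<Suc (\<phi> k)}" by auto
      from abs_le_D1[OF row_err[OF this]] show ?thesis
        using sum_lump[OF that, of m] unfolding sum_subtractf by linarith
    qed
  qed (use lim P_nonneg \<phi>_top \<eta> m in auto)
  moreover have "(\<Sum>i<J. \<Sum>j<J. c i j * p i j) \<le> K" for J
  proof (rule tendsto_upperbound)
    show "(\<lambda>k. \<Sum>i<J. \<Sum>j<J. c i j * P (\<phi> k) (i, j)) \<longlonglongrightarrow> (\<Sum>i<J. \<Sum>j<J. c i j * p i j)"
      by (intro tendsto_intros lim)
    have "\<forall>\<^sub>F k in sequentially. J \<le> \<phi> k"
      using \<phi>_top unfolding filterlim_at_top by blast
    then show "\<forall>\<^sub>F k in sequentially. (\<Sum>i<J. \<Sum>j<J. c i j * P (\<phi> k) (i, j)) \<le> K"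
    proof eventually_elim
      case (elim k)
      let ?c = "\<lambda>i j. if i < \<phi> k \<and> j < \<phi> k then c i j else 0"
      have "(\<Sum>i<J. \<Sum>j<J. c i j * P (\<phi> k) (i, j)) = (\<Sum>i<J. \<Sum>j<J. ?c i j * P (\<phi> k) (i, j))"
        using elim by (intro sum.cong refl) auto
      also have "\<dots> \<le> (\<Sum>i<J. \<Sum>j<Suc (\<phi> k). ?c i j * P (\<phi> k) (i, j))"
        using elim c P_nonneg by (intro sum_mono sum_mono2) auto
      also have "\<dots> \<le> (\<Sum>i<Suc (\<phi> k). \<Sum>j<Suc (\<phi> k). ?c i j * P (\<phi> k) (i, j))"
        using elim c P_nonneg by (intro sum_mono2 sum_nonneg) auto
      also have "\<dots> \<le> K" by (rule P_cost)
      finally show ?case .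
    qed
  qed simp
  ultimately show thesis using that by blast
qed

section \<open>Kantorovich duality\<close>

lemma nn_integral_nat_index:
  assumes idx: "idx \<in> M \<rightarrow>\<^sub>M count_space (UNIV :: nat set)" and fin: "finite_measure M"
  shows "(\<integral>\<^sup>+y. F (idx y) \<partial>M) = (\<Sum>j. F j * ennreal (measure M (idx -` {j} \<inter> space M)))"
proof -
  have sets: "idx -` {j} \<inter> space M \<in> sets M" for j
    using idx by (rule measurable_sets) simp
  have "(\<integral>\<^sup>+y. F (idx y) \<partial>M) = (\<integral>\<^sup>+y. (\<Sum>j. F j * indicator (idx -` {j} \<inter> space M) y) \<partial>M)"
  proof (rule nn_integral_cong)
    fix y assume y: "y \<in> space M"
    have "(\<Sum>j. F j * indicator (idx -` {j} \<inter> space M) y) =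
        (\<Sum>j\<in>{idx y}. F j * indicator (idx -` {j} \<inter> space M) y)"
      by (rule suminf_finite) (auto simp: indicator_def)
    then show "F (idx y) = (\<Sum>j. F j * indicator (idx -` {j} \<inter> space M) y)" using y by simp
  qed
  also have "\<dots> = (\<Sum>j. \<integral>\<^sup>+y. F j * indicator (idx -` {j} \<inter> space M) y \<partial>M)"
    using sets by (intro nn_integral_suminf) auto
  also have "\<dots> = (\<Sum>j. F j * ennreal (measure M (idx -` {j} \<inter> space M)))"
    using sets finite_measure.emeasure_eq_measure[OF fin] by (simp add: nn_integral_cmult_indicator)
  finally show ?thesis .
qed

lemma double_suminf_le:
  fixes a :: "nat \<Rightarrow> nat \<Rightarrow> real"
  assumes "\<And>i j. 0 \<le> a i j" "\<And>J. (\<Sum>i<J. \<Sum>j<J. a i j) \<le> B"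
  shows "(\<Sum>i. \<Sum>j. ennreal (a i j)) \<le> ennreal B"
proof (rule suminf_le_const[OF summableI])
  fix I
  have "(\<Sum>i<I. \<Sum>j. ennreal (a i j)) = (\<Sum>j. \<Sum>i<I. ennreal (a i j))"
    by (rule suminf_sum[symmetric]) (rule summableI)
  also have "\<dots> \<le> ennreal B"
  proof (rule suminf_le_const[OF summableI])
    fix J
    have "(\<Sum>j<J. \<Sum>i<I. a i j) \<le> (\<Sum>j<max I J. \<Sum>i<max I J. a i j)"
      using assms(1) by (intro order_trans[OF sum_mono sum_mono2] sum_mono2 sum_nonneg) auto
    also have "\<dots> = (\<Sum>i<max I J. \<Sum>j<max I J. a i j)" by (rule sum.swap)
    also have "\<dots> \<le> B" by (rule assms(2))
    finally show "(\<Sum>j<J. \<Sum>i<I. ennreal (a i j)) \<le> ennreal B"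
      using assms(1) by (simp add: sum_nonneg ennreal_leI)
  qed
  finally show "(\<Sum>i<I. \<Sum>j. ennreal (a i j)) \<le> ennreal B" .
qed

text \<open>A measurable map \<open>idx\<close> into \<open>nat\<close> partitions the space into cells. The coupling moves mass
  from cell \<open>i\<close> to cell \<open>j\<close> according to \<open>p i j\<close> and independently within the cells.\<close>

locale cell_coupling =
  fixes \<mu> \<nu> :: "'a measure" and idx :: "'a \<Rightarrow> nat" and p :: "nat \<Rightarrow> nat \<Rightarrow> real" and m n
  assumes mu: "prob_space \<mu>" and nu: "prob_space \<nu>"
    and idx_mu: "idx \<in> \<mu> \<rightarrow>\<^sub>M count_space UNIV" and idx_nu: "idx \<in> \<nu> \<rightarrow>\<^sub>M count_space UNIV"
    and m: "\<And>i. m i = measure \<mu> (idx -` {i} \<inter> space \<mu>)"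
    and n: "\<And>j. n j = measure \<nu> (idx -` {j} \<inter> space \<nu>)"
    and p: "\<And>i j. 0 \<le> p i j" and row: "\<And>i. (\<lambda>j. p i j) sums m i" and col: "\<And>j. (\<lambda>i. p i j) sums n j"
begin

lemma m_nonneg: "0 \<le> m i" and n_nonneg: "0 \<le> n i"
  by (simp_all add: m n)

lemma p_le: "p i j \<le> m i" "p i j \<le> n j"
proof -
  have "(\<Sum>j\<in>{j}. p i j) \<le> (\<Sum>j. p i j)"
    using row p by (intro sum_le_suminf) (auto simp: sums_iff)
  then show "p i j \<le> m i" using row[of i] by (simp add: sums_iff)
  have "(\<Sum>i\<in>{i}. p i j) \<le> (\<Sum>i. p i j)"
    using col p by (intro sum_le_suminf) (auto simp: sums_iff)
  then show "p i j \<le> n j" using col[of j] by (simp add: sums_iff)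
qed

lemma p_zero: "m i = 0 \<Longrightarrow> p i j = 0" "n j = 0 \<Longrightarrow> p i j = 0"
  using p_le[of i j] p[of i j] by auto

definition dens :: "'a \<times> 'a \<Rightarrow> ennreal" where
  "dens w = ennreal (p (idx (fst w)) (idx (snd w)) / (m (idx (fst w)) * n (idx (snd w))))"

definition glue :: "('a \<times> 'a) measure" where
  "glue = density (\<mu> \<Otimes>\<^sub>M \<nu>) dens"

lemma measurable_cell_function:
  fixes H :: "nat \<Rightarrow> nat \<Rightarrow> ennreal"
  shows "(\<lambda>w. H (idx (fst w)) (idx (snd w))) \<in> borel_measurable (\<mu> \<Otimes>\<^sub>M \<nu>)"
proof (rule measurable_compose_countable[where g = "\<lambda>w. idx (fst w)" and f = "\<lambda>i w. H i (idx (snd w))"])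
  show "(\<lambda>w. idx (fst w)) \<in> \<mu> \<Otimes>\<^sub>M \<nu> \<rightarrow>\<^sub>M count_space UNIV"
    by (rule measurable_compose[OF measurable_fst idx_mu])
  show "(\<lambda>w. H i (idx (snd w))) \<in> borel_measurable (\<mu> \<Otimes>\<^sub>M \<nu>)" for i
    by (rule measurable_compose[OF measurable_compose[OF measurable_snd idx_nu]]) simp
qed

lemma dens_measurable: "dens \<in> borel_measurable (\<mu> \<Otimes>\<^sub>M \<nu>)"
  using measurable_cell_function[of "\<lambda>i j. ennreal (p i j / (m i * n j))"]
  by (simp add: dens_def[abs_def])

lemma AE_cell_pos:
  assumes M: "finite_measure M" "idx \<in> M \<rightarrow>\<^sub>M count_space UNIV"
  shows "AE x in M. 0 < measure M (idx -` {idx x} \<inter> space M)"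
proof -
  interpret finite_measure M by fact
  have "AE x in M. idx x = i \<longrightarrow> 0 < measure M (idx -` {i} \<inter> space M)" for i
  proof (cases "measure M (idx -` {i} \<inter> space M) = 0")
    case True
    then have "idx -` {i} \<inter> space M \<in> null_sets M"
      using measurable_sets[OF M(2), of "{i}"] by (auto simp: null_sets_def emeasure_eq_measure)
    then show ?thesis by (rule AE_I') auto
  qed (auto simp: zero_less_measure_iff)
  then have "AE x in M. \<forall>i. idx x = i \<longrightarrow> 0 < measure M (idx -` {i} \<inter> space M)"
    unfolding AE_all_countable by blast
  then show ?thesis by (rule AE_mp) auto
qed

lemma cell_average:
  assumes M: "finite_measure M" "idx \<in> M \<rightarrow>\<^sub>M count_space UNIV"
    and k: "\<And>j. k j = measure M (idx -` {j} \<inter> space M)"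
    and q: "\<And>j. 0 \<le> q j" "q sums r" "\<And>j. k j = 0 \<Longrightarrow> q j = 0" and r: "0 < r"
  shows "(\<integral>\<^sup>+y. ennreal (q (idx y) / (r * k (idx y))) \<partial>M) = 1"
proof -
  have "(\<integral>\<^sup>+y. ennreal (q (idx y) / (r * k (idx y))) \<partial>M) = (\<Sum>j. ennreal (q j / (r * k j)) * ennreal (k j))"
    using nn_integral_nat_index[OF M(2,1), of "\<lambda>j. ennreal (q j / (r * k j))"] by (simp add: k)
  also have "\<dots> = (\<Sum>j. ennreal (q j / r))"
  proof (rule suminf_cong)
    fix j
    have "0 \<le> k j" by (simp add: k)
    then show "ennreal (q j / (r * k j)) * ennreal (k j) = ennreal (q j / r)"
      using q r by (cases "k j = 0") (auto simp: ennreal_mult'' [symmetric])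
  qed
  also have "\<dots> = ennreal (\<Sum>j. q j / r)"
    using q r by (intro suminf_ennreal2 sums_summable[OF sums_divide]) auto
  also have "(\<Sum>j. q j / r) = 1"
    using sums_unique[OF sums_divide[OF q(2), of r]] r by simp
  finally show ?thesis by simp
qed

lemma glue_in_couplings: "glue \<in> couplings \<mu> \<nu>"
proof -
  interpret mu: prob_space \<mu> by (rule mu)
  interpret nu: prob_space \<nu> by (rule nu)
  interpret pair_sigma_finite \<mu> \<nu> ..
  have "distr glue \<mu> fst = \<mu>"
  proof (rule measure_eqI)
    fix A assume "A \<in> sets (distr glue \<mu> fst)"
    then have A: "A \<in> sets \<mu>" by simp
    have ind: "(\<lambda>w. indicator A (fst w) :: ennreal) \<in> borel_measurable (\<mu> \<Otimes>\<^sub>M \<nu>)"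
      using A by measurable
    have "emeasure (distr glue \<mu> fst) A = (\<integral>\<^sup>+w. dens w * indicator A (fst w) \<partial>(\<mu> \<Otimes>\<^sub>M \<nu>))"
      using A dens_measurable unfolding glue_def
      by (subst emeasure_distr) (auto simp: emeasure_density measurable_sets[OF measurable_fst A]
          indicator_def space_pair_measure intro!: nn_integral_cong)
    also have "\<dots> = (\<integral>\<^sup>+x. \<integral>\<^sup>+y. dens (x, y) * indicator A x \<partial>\<nu> \<partial>\<mu>)"
      using dens_measurable ind by (subst nu.nn_integral_fst[symmetric]) auto
    also have "\<dots> = (\<integral>\<^sup>+x. indicator A x \<partial>\<mu>)"
    proof (rule nn_integral_cong_AE)
      show "AE x in \<mu>. (\<integral>\<^sup>+y. dens (x, y) * indicator A x \<partial>\<nu>) = indicator A x"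
        using AE_cell_pos[OF mu.finite_measure_axioms idx_mu]
      proof eventually_elim
        case (elim x)
        have "(\<integral>\<^sup>+y. dens (x, y) \<partial>\<nu>) = 1"
          using cell_average[OF nu.finite_measure_axioms idx_nu n p row p_zero(2), of "idx x"] elim
          by (simp add: dens_def m)
        then show ?case by (auto simp: indicator_def)
      qed
    qed
    also have "\<dots> = emeasure \<mu> A" using A by simp
    finally show "emeasure (distr glue \<mu> fst) A = emeasure \<mu> A" .
  qed simp
  moreover have "distr glue \<nu> snd = \<nu>"
  proof (rule measure_eqI)
    fix A assume "A \<in> sets (distr glue \<nu> snd)"
    then have A: "A \<in> sets \<nu>" by simp
    have ind: "(\<lambda>w. indicator A (snd w) :: ennreal) \<in> borel_measurable (\<mu> \<Otimes>\<^sub>M \<nu>)"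
      using A by measurable
    have "emeasure (distr glue \<nu> snd) A = (\<integral>\<^sup>+w. dens w * indicator A (snd w) \<partial>(\<mu> \<Otimes>\<^sub>M \<nu>))"
      using A dens_measurable unfolding glue_def
      by (subst emeasure_distr) (auto simp: emeasure_density measurable_sets[OF measurable_snd A]
          indicator_def space_pair_measure intro!: nn_integral_cong)
    also have "\<dots> = (\<integral>\<^sup>+y. \<integral>\<^sup>+x. dens (x, y) * indicator A y \<partial>\<mu> \<partial>\<nu>)"
      using dens_measurable ind by (subst nn_integral_snd[symmetric]) auto
    also have "\<dots> = (\<integral>\<^sup>+y. indicator A y \<partial>\<nu>)"
    proof (rule nn_integral_cong_AE)
      show "AE y in \<nu>. (\<integral>\<^sup>+x. dens (x, y) * indicator A y \<partial>\<mu>) = indicator A y"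
        using AE_cell_pos[OF nu.finite_measure_axioms idx_nu]
      proof eventually_elim
        case (elim y)
        have "(\<integral>\<^sup>+x. dens (x, y) \<partial>\<mu>) = 1"
          using cell_average[OF mu.finite_measure_axioms idx_mu m p col p_zero(1), of "idx y"] elim
          by (simp add: dens_def n mult.commute)
        then show ?case by (auto simp: indicator_def)
      qed
    qed
    also have "\<dots> = emeasure \<nu> A" using A by simp
    finally show "emeasure (distr glue \<nu> snd) A = emeasure \<nu> A" .
  qed simp
  ultimately show ?thesis by (simp add: couplings_def glue_def)
qed

lemma nn_integral_glue_le:
  fixes G :: "nat \<Rightarrow> nat \<Rightarrow> ennreal"
  shows "(\<integral>\<^sup>+w. G (idx (fst w)) (idx (snd w)) \<partial>glue) \<le> (\<Sum>i. \<Sum>j. G i j * ennreal (p i j))"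
proof -
  interpret mu: prob_space \<mu> by (rule mu)
  interpret nu: prob_space \<nu> by (rule nu)
  define H where "H i j = ennreal (p i j / (m i * n j)) * G i j" for i j
  have "(\<integral>\<^sup>+w. G (idx (fst w)) (idx (snd w)) \<partial>glue) =
      (\<integral>\<^sup>+w. H (idx (fst w)) (idx (snd w)) \<partial>(\<mu> \<Otimes>\<^sub>M \<nu>))"
    unfolding glue_def
    by (subst nn_integral_density[OF dens_measurable measurable_cell_function]) (simp add: dens_def H_def)
  also have "\<dots> = (\<integral>\<^sup>+x. \<integral>\<^sup>+y. H (idx x) (idx y) \<partial>\<nu> \<partial>\<mu>)"
    by (subst nu.nn_integral_fst[OF measurable_cell_function, symmetric]) simp
  also have "\<dots> = (\<integral>\<^sup>+x. (\<Sum>j. H (idx x) j * ennreal (n j)) \<partial>\<mu>)"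
    using nn_integral_nat_index[OF idx_nu nu.finite_measure_axioms] by (simp add: n)
  also have "\<dots> = (\<Sum>i. (\<Sum>j. H i j * ennreal (n j)) * ennreal (m i))"
    using nn_integral_nat_index[OF idx_mu mu.finite_measure_axioms,
        of "\<lambda>i. \<Sum>j. H i j * ennreal (n j)"] by (simp add: m)
  also have "\<dots> = (\<Sum>i. \<Sum>j. H i j * ennreal (n j) * ennreal (m i))" by simp
  also have "\<dots> \<le> (\<Sum>i. \<Sum>j. G i j * ennreal (p i j))"
  proof (intro suminf_le summableI)
    fix i j
    have "ennreal (p i j / (m i * n j)) * ennreal (n j) * ennreal (m i) =
        ennreal (p i j / (m i * n j) * n j * m i)"
      using p[of i j] m_nonneg[of i] n_nonneg[of j] by (simp add: ennreal_mult[symmetric])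
    also have "\<dots> \<le> ennreal (p i j)"
      using p[of i j] by (intro ennreal_leI) (cases "m i = 0 \<or> n j = 0", auto)
    finally have "G i j * (ennreal (p i j / (m i * n j)) * ennreal (n j) * ennreal (m i)) \<le>
        G i j * ennreal (p i j)" by (rule mult_left_mono) simp
    then show "H i j * ennreal (n j) * ennreal (m i) \<le> G i j * ennreal (p i j)"
      by (simp add: H_def mult_ac)
  qed
  finally show ?thesis .
qed

end

lemma small_cells:
  fixes \<delta> :: real
  assumes "0 < \<delta>"
  obtains idx :: "'a::{second_countable_topology, metric_space} \<Rightarrow> nat" and a :: "nat \<Rightarrow> 'a"
  where "idx \<in> borel \<rightarrow>\<^sub>M count_space UNIV" "\<And>x. dist x (a (idx x)) < \<delta>"
proof -
  obtain D :: "'a set" where D: "countable D" "\<And>X. open X \<Longrightarrow> X \<noteq> {} \<Longrightarrow> \<exists>d\<in>D. d \<in> X"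
    using countable_dense_exists by blast
  have "D \<noteq> {}" using D(2)[OF open_UNIV] by auto
  define a where "a = from_nat_into D"
  define idx where "idx x = (LEAST i. dist x (a i) < \<delta>)" for x
  have ex: "\<exists>i. dist x (a i) < \<delta>" for x
  proof -
    obtain d where d: "d \<in> D" "d \<in> ball x \<delta>"
      using D(2)[of "ball x \<delta>"] assms by auto
    obtain i where "a i = d"
      using range_from_nat_into[OF \<open>D \<noteq> {}\<close> D(1)] d(1) unfolding a_def by (metis imageE)
    then show ?thesis using d(2) by auto
  qed
  show thesis
  proof (rule that)
    show "idx \<in> borel \<rightarrow>\<^sub>M count_space UNIV"
      unfolding idx_def by measurable
    show "dist x (a (idx x)) < \<delta>" for x
      unfolding idx_def by (rule LeastI_ex[OF ex])
  qed
qed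

lemma integral_lump:
  fixes idx :: "'a \<Rightarrow> nat"
  assumes mu: "prob_space \<mu>" and idx: "idx \<in> \<mu> \<rightarrow>\<^sub>M count_space UNIV"
  shows "(\<integral>x. f (min (idx x) N) \<partial>\<mu>) =
    (\<Sum>i<Suc N. f i * lump N (\<lambda>i. measure \<mu> (idx -` {i} \<inter> space \<mu>)) i)"
proof -
  interpret prob_space \<mu> by (rule mu)
  have sets: "idx -` {j} \<inter> space \<mu> \<in> sets \<mu>" for j
    using idx by (rule measurable_sets) simp
  let ?m = "\<lambda>i. measure \<mu> (idx -` {i} \<inter> space \<mu>)"
  have "(\<integral>x. f (min (idx x) N) \<partial>\<mu>) =
    (\<integral>x. f N + (\<Sum>i<N. (f i - f N) * indicator (idx -` {i} \<inter> space \<mu>) x) \<partial>\<mu>)"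
  proof (rule Bochner_Integration.integral_cong[OF refl])
    fix x assume x: "x \<in> space \<mu>"
    have "(\<Sum>i<N. (f i - f N) * indicator (idx -` {i} \<inter> space \<mu>) x) =
        (\<Sum>i<N. if i = idx x then f (idx x) - f N else 0)"
      using x by (intro sum.cong) (auto simp: indicator_def)
    then show "f (min (idx x) N) = f N + (\<Sum>i<N. (f i - f N) * indicator (idx -` {i} \<inter> space \<mu>) x)"
      by (auto simp: min_def)
  qed
  also have "\<dots> = f N + (\<Sum>i<N. (f i - f N) * ?m i)"
  proof -
    have int: "integrable \<mu> (\<lambda>x. (f i - f N) * indicator (idx -` {i} \<inter> space \<mu>) x)" for i
      using sets by (intro integrable_mult_right) (simp add: emeasure_eq_measure)
    have "(\<integral>x. (\<Sum>i<N. (f i - f N) * indicator (idx -` {i} \<inter> space \<mu>) x) \<partial>\<mu>) = (\<Sum>i<N. (f i - f N) * ?m i)"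
      using sets by (subst Bochner_Integration.integral_sum[OF int]) simp
    then show ?thesis
      by (subst Bochner_Integration.integral_add[OF integrable_const Bochner_Integration.integrable_sum[OF int]])
        (simp add: prob_space)
  qed
  also have "\<dots> = (\<Sum>i<N. f i * ?m i) + f N * (1 - (\<Sum>i<N. ?m i))"
    by (simp add: left_diff_distrib right_diff_distrib sum_subtractf sum_distrib_left)
  also have "\<dots> = (\<Sum>i<Suc N. f i * lump N ?m i)"
    by (simp add: lump_def)
  finally show ?thesis .
qed

lemma cell_masses_sums_1:
  fixes idx :: "'a \<Rightarrow> nat"
  assumes mu: "prob_space \<mu>" and idx: "idx \<in> \<mu> \<rightarrow>\<^sub>M count_space UNIV"
  shows "(\<lambda>i. measure \<mu> (idx -` {i} \<inter> space \<mu>)) sums 1"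
proof -
  interpret prob_space \<mu> by (rule mu)
  have "(\<lambda>i. measure \<mu> (idx -` {i} \<inter> space \<mu>)) sums measure \<mu> (\<Union>i. idx -` {i} \<inter> space \<mu>)"
    using measurable_sets[OF idx]
    by (intro finite_measure_UNION) (auto simp: disjoint_family_on_def)
  also have "(\<Union>i. idx -` {i} \<inter> space \<mu>) = space \<mu>" by auto
  finally show ?thesis by (simp add: prob_space)
qed

text \<open>The hard half of Kantorovich duality for the quadratic cost. Replacing the cost by its
  approximate infimum over pairs of small cells loses only a factor \<open>1 + \<delta>\<close> and an additive
  error of order \<open>\<delta>\<close>, uniformly over all distances, and functions that are constant on cells
  are legitimate bounded Borel potentials.\<close>

theorem transport_cost_le_dual_bound:
  fixes \<mu> \<nu> :: "'a::{second_countable_topology, metric_space} measure"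
  assumes \<mu>: "\<mu> \<in> space (prob_algebra borel)" and \<nu>: "\<nu> \<in> space (prob_algebra borel)"
    and dual: "\<And>f g M. f \<in> borel_measurable borel \<Longrightarrow> g \<in> borel_measurable borel \<Longrightarrow>
      (\<And>z. \<bar>f z\<bar> \<le> M) \<Longrightarrow> (\<And>z. \<bar>g z\<bar> \<le> M) \<Longrightarrow> (\<And>x y. g y - f x \<le> (dist x y)\<^sup>2) \<Longrightarrow>
      (\<integral>z. g z \<partial>\<nu>) - (\<integral>z. f z \<partial>\<mu>) \<le> K"
  shows "(INF \<pi> \<in> couplings \<mu> \<nu>. \<integral>\<^sup>+ (x, y). ennreal ((dist x y)\<^sup>2) \<partial>\<pi>) \<le> ennreal K"
proof -
  have mu: "prob_space \<mu>" "sets \<mu> = sets borel" and nu: "prob_space \<nu>" "sets \<nu> = sets borel"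
    using \<mu> \<nu> by (auto simp: space_prob_algebra)
  have K: "0 \<le> K" using dual[of "\<lambda>_. 0" "\<lambda>_. 0" 0] by simp
  let ?W = "INF \<pi> \<in> couplings \<mu> \<nu>. \<integral>\<^sup>+ (x, y). ennreal ((dist x y)\<^sup>2) \<partial>\<pi>"
  have approx: "?W \<le> ennreal ((1 + \<delta>) * K + (1 + 1 / \<delta>) * (4 * \<delta>)\<^sup>2)" if \<delta>: "0 < \<delta>" for \<delta> :: real
  proof -
    obtain idx :: "'a \<Rightarrow> nat" and a where idx: "idx \<in> borel \<rightarrow>\<^sub>M count_space UNIV"
      and near: "\<And>x. dist x (a (idx x)) < \<delta>" using small_cells[OF \<delta>] by metis
    have idx_mu: "idx \<in> \<mu> \<rightarrow>\<^sub>M count_space UNIV" and idx_nu: "idx \<in> \<nu> \<rightarrow>\<^sub>M count_space UNIV"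
      using idx by (simp_all add: measurable_cong_sets[OF mu(2) refl] measurable_cong_sets[OF nu(2) refl])
    define m where "m i = measure \<mu> (idx -` {i} \<inter> space \<mu>)" for i
    define n where "n i = measure \<nu> (idx -` {i} \<inter> space \<nu>)" for i
    \<comment> \<open>\<open>e i j\<close> is a lower bound for the distance between points of the cells \<open>i\<close> and \<open>j\<close>, so that
      cellwise admissible potentials are admissible for \<open>d\<^sup>2\<close>.\<close>
    define e where "e i j = max 0 (dist (a i) (a j) - 2 * \<delta>)" for i j
    have e: "0 \<le> e i j" for i j by (simp add: e_def)
    have e_le: "e (idx x) (idx y) \<le> dist x y" and dist_le: "dist x y \<le> e (idx x) (idx y) + 4 * \<delta>" for x y
    proof -
      have "dist (a (idx x)) (a (idx y)) \<le> dist x (a (idx x)) + dist x y + dist y (a (idx y))"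
        by metric
      then show "e (idx x) (idx y) \<le> dist x y"
        using near[of x] near[of y] by (auto simp: e_def)
      have "dist x y \<le> dist x (a (idx x)) + dist (a (idx x)) (a (idx y)) + dist y (a (idx y))"
        by metric
      then show "dist x y \<le> e (idx x) (idx y) + 4 * \<delta>"
        using near[of x] near[of y] by (auto simp: e_def)
    qed
    have bound: "(\<Sum>j<Suc N. g j * lump N n j) - (\<Sum>i<Suc N. f i * lump N m i) \<le> K"
      if fg: "\<And>i j. i \<le> N \<Longrightarrow> j \<le> N \<Longrightarrow> g j - f i \<le> (if i < N \<and> j < N then (e i j)\<^sup>2 else 0)" for N f g
    proof -
      define M where "M = (\<Sum>i\<le>N. \<bar>f i\<bar> + \<bar>g i\<bar>)"
      have M: "\<bar>f (min i N)\<bar> \<le> M" "\<bar>g (min i N)\<bar> \<le> M" for i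
        using member_le_sum[of "min i N" "{..N}" "\<lambda>i. \<bar>f i\<bar> + \<bar>g i\<bar>"] by (auto simp: M_def)
      have meas: "(\<lambda>z. h (min (idx z) N)) \<in> borel_measurable borel" for h :: "nat \<Rightarrow> real"
        by (rule measurable_compose[OF idx]) simp
      have "(\<integral>y. g (min (idx y) N) \<partial>\<nu>) - (\<integral>x. f (min (idx x) N) \<partial>\<mu>) \<le> K"
      proof (rule dual)
        fix x y
        have "g (min (idx y) N) - f (min (idx x) N) \<le>
            (if min (idx x) N < N \<and> min (idx y) N < N then (e (min (idx x) N) (min (idx y) N))\<^sup>2 else 0)"
          by (rule fg) auto
        also have "\<dots> \<le> (e (idx x) (idx y))\<^sup>2" by auto
        also have "\<dots> \<le> (dist x y)\<^sup>2" using e_le e by (intro power_mono)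
        finally show "g (min (idx y) N) - f (min (idx x) N) \<le> (dist x y)\<^sup>2" .
      qed (use M meas in auto)
      then show ?thesis
        unfolding integral_lump[OF mu(1) idx_mu] integral_lump[OF nu(1) idx_nu] m_def n_def .
    qed
    obtain p where p: "\<And>i j. 0 \<le> p i j" "\<And>i. (\<lambda>j. p i j) sums m i" "\<And>j. (\<lambda>i. p i j) sums n j"
      and cost: "\<And>J. (\<Sum>i<J. \<Sum>j<J. (e i j)\<^sup>2 * p i j) \<le> K"
    proof (rule countable_transport[of "\<lambda>i j. (e i j)\<^sup>2" m n K])
      show "m sums 1" "n sums 1"
        unfolding m_def n_def using cell_masses_sums_1[OF mu(1) idx_mu] cell_masses_sums_1[OF nu(1) idx_nu] .
    qed (use bound in \<open>auto simp: m_def n_def\<close>)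
    interpret cell_coupling \<mu> \<nu> idx p m n
      by (rule cell_coupling.intro) (fact mu(1) nu(1) idx_mu idx_nu m_def n_def p)+
    define \<kappa> where "\<kappa> = (1 + 1 / \<delta>) * (4 * \<delta>)\<^sup>2"
    have \<kappa>: "0 \<le> \<kappa>" using \<delta> by (simp add: \<kappa>_def)
    have sq: "(dist x y)\<^sup>2 \<le> (1 + \<delta>) * (e (idx x) (idx y))\<^sup>2 + \<kappa>" for x y
    proof -
      let ?e = "e (idx x) (idx y)"
      have "(dist x y)\<^sup>2 \<le> (?e + 4 * \<delta>)\<^sup>2" by (intro power_mono dist_le) simp
      also have "\<dots> = ?e\<^sup>2 + 2 * (\<delta> * ?e) * 4 + (4 * \<delta>)\<^sup>2" by (simp add: power2_sum)
      also have "\<dots> \<le> ?e\<^sup>2 + (\<delta> * ?e\<^sup>2 + 16 * \<delta>) + (4 * \<delta>)\<^sup>2"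
      proof -
        have "0 \<le> \<delta> * (?e - 4)\<^sup>2" using \<delta> by simp
        then show ?thesis by (simp add: power2_diff algebra_simps)
      qed
      also have "\<dots> = (1 + \<delta>) * ?e\<^sup>2 + \<kappa>"
        using \<delta> by (simp add: \<kappa>_def power2_eq_square field_simps)
      finally show ?thesis .
    qed
    have mass: "(\<Sum>i<J. \<Sum>j<J. p i j) \<le> 1" for J
    proof -
      have "(\<Sum>j<J. p i j) \<le> m i" for i
        using row[of i] p sum_le_suminf[of "p i" "{..<J}"] by (auto simp: sums_iff)
      then have "(\<Sum>i<J. \<Sum>j<J. p i j) \<le> (\<Sum>i<J. m i)" by (rule sum_mono)
      also have "\<dots> \<le> 1"
        using cell_masses_sums_1[OF mu(1) idx_mu] m_nonneg sum_le_suminf[of m "{..<J}"]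
        by (auto simp: sums_iff m_def[symmetric])
      finally show ?thesis .
    qed
    have "?W \<le> (\<integral>\<^sup>+ (x, y). ennreal ((dist x y)\<^sup>2) \<partial>glue)"
      by (rule INF_lower[OF glue_in_couplings])
    also have "\<dots> \<le> (\<integral>\<^sup>+ w. ennreal ((1 + \<delta>) * (e (idx (fst w)) (idx (snd w)))\<^sup>2 + \<kappa>) \<partial>glue)"
      by (intro nn_integral_mono) (auto intro!: ennreal_leI sq)
    also have "\<dots> \<le> (\<Sum>i. \<Sum>j. ennreal ((1 + \<delta>) * (e i j)\<^sup>2 + \<kappa>) * ennreal (p i j))"
      by (rule nn_integral_glue_le)
    also have "\<dots> = (\<Sum>i. \<Sum>j. ennreal (((1 + \<delta>) * (e i j)\<^sup>2 + \<kappa>) * p i j))"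
      using \<delta> \<kappa> p by (simp add: ennreal_mult)
    also have "\<dots> \<le> ennreal ((1 + \<delta>) * K + \<kappa>)"
    proof (rule double_suminf_le)
      show "0 \<le> ((1 + \<delta>) * (e i j)\<^sup>2 + \<kappa>) * p i j" for i j using \<delta> \<kappa> p by simp
      fix J
      have "(\<Sum>i<J. \<Sum>j<J. ((1 + \<delta>) * (e i j)\<^sup>2 + \<kappa>) * p i j) =
          (1 + \<delta>) * (\<Sum>i<J. \<Sum>j<J. (e i j)\<^sup>2 * p i j) + \<kappa> * (\<Sum>i<J. \<Sum>j<J. p i j)"
        by (simp add: sum_distrib_left sum.distrib distrib_right mult.assoc)
      also have "\<dots> \<le> (1 + \<delta>) * K + \<kappa> * 1"
        using \<delta> \<kappa> cost mass by (intro add_mono mult_left_mono) auto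
      finally show "(\<Sum>i<J. \<Sum>j<J. ((1 + \<delta>) * (e i j)\<^sup>2 + \<kappa>) * p i j) \<le> (1 + \<delta>) * K + \<kappa>" by simp
    qed
    finally show ?thesis by (simp add: \<kappa>_def)
  qed
  show ?thesis
  proof (rule ennreal_le_epsilon)
    fix r :: real assume r: "0 < r"
    define \<delta> where "\<delta> = min 1 (r / (K + 32))"
    have "\<delta> \<le> r / (K + 32)" by (simp add: \<delta>_def)
    then have "\<delta> * (K + 32) \<le> r" using K by (simp add: pos_le_divide_eq)
    moreover have "0 < \<delta>" "\<delta> \<le> 1" using r K by (simp_all add: \<delta>_def)
    ultimately have \<delta>: "0 < \<delta>" "\<delta> \<le> 1" "\<delta> * (K + 32) \<le> r" by blast+
    have "(1 + \<delta>) * K + (1 + 1 / \<delta>) * (4 * \<delta>)\<^sup>2 = K + \<delta> * (K + 16 + 16 * \<delta>)"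
      using \<delta> by (simp add: power2_eq_square field_simps)
    also have "\<dots> \<le> K + \<delta> * (K + 32)"
      using \<delta> by (intro add_left_mono mult_left_mono) auto
    also have "\<dots> \<le> K + r" using \<delta>(3) by simp
    finally have "ennreal ((1 + \<delta>) * K + (1 + 1 / \<delta>) * (4 * \<delta>)\<^sup>2) \<le> ennreal (K + r)"
      by (rule ennreal_leI)
    also have "\<dots> = ennreal K + ennreal r" using K r by simp
    finally show "?W \<le> ennreal K + ennreal r" by (rule order_trans[OF approx[OF \<delta>(1)]])
  qed
qed

section \<open>Contraction of the transport distances\<close>

lemma (in gradient_kernel) bind_P_in_prob_algebra:
  assumes "\<mu> \<in> space (prob_algebra borel)"
  shows "\<mu> \<bind> P \<in> space (prob_algebra borel)"
proof -
  have \<mu>: "prob_space \<mu>" "sets \<mu> = sets borel" using assms by (auto simp: space_prob_algebra)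
  interpret prob_space \<mu> by (rule \<mu>(1))
  have "P \<in> \<mu> \<rightarrow>\<^sub>M subprob_algebra borel"
    using P_subprob_meas by (simp add: measurable_cong_sets[OF \<mu>(2) refl])
  then have "prob_space (\<mu> \<bind> P)" by (intro prob_space_bind) (simp add: P_prob)
  moreover have "sets (\<mu> \<bind> P) = sets borel" using not_empty by (intro sets_bind P_sets)
  ultimately show ?thesis by (simp add: space_prob_algebra)
qed

text \<open>Duality is applied to the image measures. Their potentials pull back under \<open>P\<close> to
  potentials for \<open>C d\<^sup>2\<close>, and these are integrated against the given coupling of the original
  measures. This avoids a measurable choice of couplings of \<open>P x\<close> and \<open>P y\<close>.\<close>

lemma (in gradient_kernel) transport_cost_bind_le:
  assumes \<mu>\<^sub>0: "\<mu>\<^sub>0 \<in> space (prob_algebra borel)" and \<mu>\<^sub>1: "\<mu>\<^sub>1 \<in> space (prob_algebra borel)"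
    and \<pi>: "\<pi> \<in> couplings \<mu>\<^sub>0 \<mu>\<^sub>1"
  shows "(W2 (\<mu>\<^sub>0 \<bind> P) (\<mu>\<^sub>1 \<bind> P))\<^sup>2 \<le>
    ennreal C * (\<integral>\<^sup>+ (x, y). ennreal ((dist x y)\<^sup>2) \<partial>\<pi>)"
    (is "_ \<le> ennreal C * ?I")
proof (cases "ennreal C * ?I = \<infinity>")
  case False
  then obtain K where K: "0 \<le> K" "ennreal C * ?I = ennreal K"
    by (cases "ennreal C * ?I") auto
  have prob0: "prob_space \<mu>\<^sub>0" "sets \<mu>\<^sub>0 = sets borel" and prob1: "prob_space \<mu>\<^sub>1" "sets \<mu>\<^sub>1 = sets borel"
    using \<mu>\<^sub>0 \<mu>\<^sub>1 by (auto simp: space_prob_algebra)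
  have sets_\<pi>: "sets \<pi> = sets (\<mu>\<^sub>0 \<Otimes>\<^sub>M \<mu>\<^sub>1)"
    and fst_\<pi>: "distr \<pi> \<mu>\<^sub>0 fst = \<mu>\<^sub>0" and snd_\<pi>: "distr \<pi> \<mu>\<^sub>1 snd = \<mu>\<^sub>1"
    using \<pi> by (auto simp: couplings_def)
  have fst_meas: "fst \<in> \<pi> \<rightarrow>\<^sub>M \<mu>\<^sub>0" and snd_meas: "snd \<in> \<pi> \<rightarrow>\<^sub>M \<mu>\<^sub>1"
    by (simp_all add: measurable_cong_sets[OF sets_\<pi> refl])
  have "prob_space (distr \<pi> \<mu>\<^sub>0 fst)" unfolding fst_\<pi> by (rule prob0)
  then interpret pi: prob_space \<pi> by (rule prob_space_distrD[OF fst_meas])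
  have sets_\<pi>': "sets \<pi> = sets (borel \<Otimes>\<^sub>M borel)"
    unfolding sets_\<pi> using prob0 prob1 by (intro sets_pair_measure_cong) auto
  have dist_meas: "(\<lambda>w. ennreal ((dist (fst w) (snd w))\<^sup>2)) \<in> borel_measurable \<pi>"
    unfolding measurable_cong_sets[OF sets_\<pi>' refl] by measurable
  have "(INF \<pi> \<in> couplings (\<mu>\<^sub>0 \<bind> P) (\<mu>\<^sub>1 \<bind> P). \<integral>\<^sup>+ (x, y). ennreal ((dist x y)\<^sup>2) \<partial>\<pi>) \<le> ennreal K"
  proof (rule transport_cost_le_dual_bound)
    show "\<mu>\<^sub>0 \<bind> P \<in> space (prob_algebra borel)" "\<mu>\<^sub>1 \<bind> P \<in> space (prob_algebra borel)"
      using \<mu>\<^sub>0 \<mu>\<^sub>1 by (auto intro!: bind_P_in_prob_algebra)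
    fix f g :: "'a \<Rightarrow> real" and M
    assume f: "f \<in> borel_measurable borel" "\<And>z. \<bar>f z\<bar> \<le> M"
      and g: "g \<in> borel_measurable borel" "\<And>z. \<bar>g z\<bar> \<le> M"
      and fg: "\<And>x y. g y - f x \<le> (dist x y)\<^sup>2"
    let ?F = "\<lambda>x. \<integral>z. f z \<partial>P x" and ?G = "\<lambda>y. \<integral>z. g z \<partial>P y"
    have F: "?F \<in> borel_measurable \<mu>\<^sub>0" and G: "?G \<in> borel_measurable \<mu>\<^sub>1"
      using P_integral_measurable[OF f(1)] P_integral_measurable[OF g(1)]
      by (simp_all add: measurable_cong_sets[OF prob0(2) refl] measurable_cong_sets[OF prob1(2) refl])
    have int: "integrable \<pi> (\<lambda>w. ?F (fst w))" "integrable \<pi> (\<lambda>w. ?G (snd w))"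
      using P_integral_bound[OF f] P_integral_bound[OF g]
        measurable_compose[OF fst_meas F] measurable_compose[OF snd_meas G]
      by (auto intro!: pi.integrable_const_bound[of _ M])
    have "(\<integral>z. g z \<partial>(\<mu>\<^sub>1 \<bind> P)) - (\<integral>z. f z \<partial>(\<mu>\<^sub>0 \<bind> P)) = (\<integral>y. ?G y \<partial>\<mu>\<^sub>1) - (\<integral>x. ?F x \<partial>\<mu>\<^sub>0)"
      using integral_bind_P[OF \<mu>\<^sub>0 f] integral_bind_P[OF \<mu>\<^sub>1 g] by simp
    also have "\<dots> = (\<integral>w. ?G (snd w) \<partial>\<pi>) - (\<integral>w. ?F (fst w) \<partial>\<pi>)"
      using integral_distr[OF fst_meas F] integral_distr[OF snd_meas G] by (simp add: fst_\<pi> snd_\<pi>)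
    also have "\<dots> = (\<integral>w. ?G (snd w) - ?F (fst w) \<partial>\<pi>)"
      using int by simp
    also have "\<dots> \<le> K"
    proof (rule integral_real_bounded[OF K(1)])
      have "(\<integral>\<^sup>+w. ennreal (?G (snd w) - ?F (fst w)) \<partial>\<pi>) \<le>
          (\<integral>\<^sup>+w. ennreal C * ennreal ((dist (fst w) (snd w))\<^sup>2) \<partial>\<pi>)"
        using dual_potential_contraction[OF f g fg] C_nonneg
        by (intro nn_integral_mono) (simp add: ennreal_mult[symmetric] ennreal_leI)
      also have "\<dots> = ennreal C * ?I"
        using dist_meas by (simp add: nn_integral_cmult case_prod_beta')
      finally show "(\<integral>\<^sup>+w. ennreal (?G (snd w) - ?F (fst w)) \<partial>\<pi>) \<le> ennreal K"
        unfolding K(2) .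
    qed
    finally show "(\<integral>z. g z \<partial>(\<mu>\<^sub>1 \<bind> P)) - (\<integral>z. f z \<partial>(\<mu>\<^sub>0 \<bind> P)) \<le> K" .
  qed
  then show ?thesis unfolding W2_power2 K(2) .
qed simp

lemma pair_measure_in_couplings:
  assumes "prob_space \<mu>" "prob_space \<nu>"
  shows "\<mu> \<Otimes>\<^sub>M \<nu> \<in> couplings \<mu> \<nu>"
proof -
  interpret mu: prob_space \<mu> by fact
  interpret nu: prob_space \<nu> by fact
  interpret pair_sigma_finite \<mu> \<nu> ..
  have "distr (\<mu> \<Otimes>\<^sub>M \<nu>) \<mu> fst = \<mu>"
    by (rule nu.distr_pair_fst)
  moreover have "distr (\<mu> \<Otimes>\<^sub>M \<nu>) \<nu> snd = \<nu>"
  proof (rule measure_eqI)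
    fix A assume "A \<in> sets (distr (\<mu> \<Otimes>\<^sub>M \<nu>) \<nu> snd)"
    then have A: "A \<in> sets \<nu>" by simp
    have "snd -` A \<inter> space (\<mu> \<Otimes>\<^sub>M \<nu>) = space \<mu> \<times> A"
      using sets.sets_into_space[OF A] by (auto simp: space_pair_measure)
    then show "emeasure (distr (\<mu> \<Otimes>\<^sub>M \<nu>) \<nu> snd) A = emeasure \<nu> A"
      using A by (simp add: emeasure_distr nu.emeasure_pair_measure_Times mu.emeasure_space_1)
  qed simp
  ultimately show ?thesis by (simp add: couplings_def)
qed

theorem (in gradient_kernel) W2_bind_le:
  assumes \<mu>\<^sub>0: "\<mu>\<^sub>0 \<in> space (prob_algebra borel)" and \<mu>\<^sub>1: "\<mu>\<^sub>1 \<in> space (prob_algebra borel)"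
  shows "(W2 (\<mu>\<^sub>0 \<bind> P) (\<mu>\<^sub>1 \<bind> P))\<^sup>2 \<le> ennreal C * (W2 \<mu>\<^sub>0 \<mu>\<^sub>1)\<^sup>2"
proof (cases "C = 0")
  case True
  \<comment> \<open>Since \<open>0 * \<infinity> = 0\<close>, any single coupling will do, even one of infinite cost.\<close>
  have "\<mu>\<^sub>0 \<Otimes>\<^sub>M \<mu>\<^sub>1 \<in> couplings \<mu>\<^sub>0 \<mu>\<^sub>1"
    using \<mu>\<^sub>0 \<mu>\<^sub>1 by (intro pair_measure_in_couplings) (auto simp: space_prob_algebra)
  from transport_cost_bind_le[OF \<mu>\<^sub>0 \<mu>\<^sub>1 this] show ?thesis using True by simp
next
  case False
  then have C: "0 < ennreal C" using C_nonneg by simp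
  let ?L = "(W2 (\<mu>\<^sub>0 \<bind> P) (\<mu>\<^sub>1 \<bind> P))\<^sup>2"
  have "?L / ennreal C \<le> (W2 \<mu>\<^sub>0 \<mu>\<^sub>1)\<^sup>2"
    unfolding W2_power2[of \<mu>\<^sub>0]
    by (intro INF_greatest divide_le_posI_ennreal[OF C] transport_cost_bind_le[OF \<mu>\<^sub>0 \<mu>\<^sub>1])
  then have "ennreal C * (?L / ennreal C) \<le> ennreal C * (W2 \<mu>\<^sub>0 \<mu>\<^sub>1)\<^sup>2"
    by (rule mult_left_mono) simp
  moreover have "ennreal C * (?L / ennreal C) = ?L"
    using C mult_divide_eq_ennreal[of "ennreal C" ?L] by (simp add: ennreal_times_divide mult.commute)
  ultimately show ?thesis by simp
qed

theorem corollary3p5: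
  fixes P :: "'a::{polish_space, heine_borel} \<Rightarrow> 'a measure" and C :: real
  assumes "length_space (UNIV :: 'a set)"
    and "P \<in> borel \<rightarrow>\<^sub>M prob_algebra borel"
    and "C \<ge> 0"
    and "\<And>(f :: 'a lip_b) x. (slope (\<lambda>z. \<integral>y. lip_fun f y \<partial>P z) x)\<^sup>2
           \<le> ennreal C * (\<integral>\<^sup>+y. (slope (lip_fun f) y)\<^sup>2 \<partial>P x)"
  shows "(\<forall>b\<ge>0. \<forall>\<mu>\<^sub>0\<in>space (prob_algebra borel). \<forall>\<mu>\<^sub>1\<in>space (prob_algebra borel).
           HJ_cost C b (\<mu>\<^sub>0 \<bind> P) (\<mu>\<^sub>1 \<bind> P) \<le> HJ_cost 1 b \<mu>\<^sub>0 \<mu>\<^sub>1) \<and>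
         (\<forall>\<mu>\<^sub>0\<in>space (prob_algebra borel). \<forall>\<mu>\<^sub>1\<in>space (prob_algebra borel).
           (W2 (\<mu>\<^sub>0 \<bind> P) (\<mu>\<^sub>1 \<bind> P))\<^sup>2 \<le> ennreal C * (W2 \<mu>\<^sub>0 \<mu>\<^sub>1)\<^sup>2)"
proof -
  interpret gradient_kernel P C
    by (rule gradient_kernel.intro) (fact assms)+
  show ?thesis
    using HJ_cost_bind_le W2_bind_le by blast
qed

end
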